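(* Let $n$ be a positive integer, let $H$ be an Abelian group and let $\gamma : [n]\times[n] \to H$ be simple cycle free. Then $|H| \ge 2^{n/2-2}$.
   Context: $[n]=\{1,\ldots,n\}$. The complete bipartite graph $K_{n,n}$ has two disjoint vertex classes, each a copy of $[n]$, and its edges are identified with the pairs $(x,y)\in[n]\times[n]$ ($x$ in the first class, $y$ in the second). For an Abelian group $H$ (written additively), a labeling $\gamma:[n]\times[n]\to H$ is called simple cycle free if for every simple cycle $C$ in $K_{n,n}$ (a closed walk with no repeated vertices, of length $2k$ with $k\ge 2$) one has $\sum_{e\in C}\mathrm{sign}(e)\gamma(e)\neq 0$ in $H$, where $\mathrm{sign}(e)\in\{-1,1\}$ is an alternating sign assignment to the edges of $C$ (consecutive edges along $C$ receive opposite signs; the two possible choices differ by a global sign, so the condition does not depend on the choice). *)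

theory Defs
  imports Complex_Main
begin

text \<open>The two vertex classes of \<open>K\<^sub>n\<^sub>,\<^sub>n\<close> are \<open>Inl ` {1..n}\<close> and \<open>Inr ` {1..n}\<close>.\<close>

definition Knn_adj :: "nat \<Rightarrow> nat + nat \<Rightarrow> nat + nat \<Rightarrow> bool" where
  "Knn_adj n u v \<longleftrightarrow>
     (\<exists>x\<in>{1..n}. \<exists>y\<in>{1..n}. (u = Inl x \<and> v = Inr y) \<or> (u = Inr y \<and> v = Inl x))"

text \<open>The pair in \<open>[n] \<times> [n]\<close> identified with the edge between two vertices; its first
  component is always the endpoint in the first class. Only values on adjacent vertices matter.\<close>

fun edge_pair :: "nat + nat \<Rightarrow> nat + nat \<Rightarrow> nat \<times> nat" where
  "edge_pair (Inl x) (Inr y) = (x, y)"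
| "edge_pair (Inr y) (Inl x) = (x, y)"

text \<open>A simple cycle is the list of its vertices in cyclic order; the last vertex is joined back to
  the first.\<close>

definition simple_cycle :: "nat \<Rightarrow> (nat + nat) list \<Rightarrow> bool" where
  "simple_cycle n c \<longleftrightarrow>
     (\<exists>k\<ge>2. length c = 2 * k) \<and> distinct c \<and>
     (\<forall>i<length c. Knn_adj n (c ! i) (c ! (Suc i mod length c)))"

text \<open>The \<open>i\<close>-th edge of the cycle carries sign \<open>(-1)\<^sup>i\<close>, which alternates also across the
  closing edge because the length is even. Rotating the list by one yields the other choice.\<close>

definition alternating_sum :: "(nat \<times> nat \<Rightarrow> 'h::ab_group_add) \<Rightarrow> (nat + nat) list \<Rightarrow> 'h" where
  "alternating_sum \<gamma> c =
     (\<Sum>i<length c. let e = edge_pair (c ! i) (c ! (Suc i mod length c))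
                    in if even i then \<gamma> e else - \<gamma> e)"

definition simple_cycle_free :: "nat \<Rightarrow> (nat \<times> nat \<Rightarrow> 'h::ab_group_add) \<Rightarrow> bool" where
  "simple_cycle_free n \<gamma> \<longleftrightarrow> (\<forall>c. simple_cycle n c \<longrightarrow> alternating_sum \<gamma> c \<noteq> 0)"

end

theory Submission
  imports Defs "Jordan_Normal_Form.Determinant" "HOL-Combinatorics.Cycles"
begin

text \<open>Permutations of \<open>[n]\<close> with equal label sums never differ by a single cycle, so it suffices to
  bound the size of a family \<open>A\<close> of permutations of the same sign with this property, for \<open>n\<close> odd.
  Let \<open>F j\<close> be the squared Hilbert--Schmidt norm of \<open>\<Sum>f\<in>A. f\<close> acting on the \<open>j\<close>-th exterior power of the
  standard representation. The alternating sum of the characters of these powers is \<open>det (1 - \<sigma>)\<close>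
  on the standard representation and vanishes unless \<open>\<sigma>\<close> is an \<open>n\<close>-cycle, so \<open>\<Sum>j<n. (-1) ^ j * F j = 0\<close>,
  whereas \<open>F 0 = F (n - 1) = \<bar>A\<bar>\<^sup>2\<close>. The branching rule
  gives \<open>\<Sum>i i'. F j {f \<in> A. f i = i'} \<ge> F j A + F (j + 1) A\<close>; iterated \<open>k\<close> times it bounds
  \<open>\<Sum>i. (k choose i) * F i\<close> by the sum of the squared sizes of the families obtained from \<open>A\<close> by
  prescribing \<open>k\<close> values. If \<open>\<bar>A\<bar> * 2 ^ ((n - 1) div 2) > n!\<close>, induction on \<open>n\<close> bounds that sum
  by \<open>2 ^ (k div 2) * \<bar>A\<bar>\<^sup>2\<close> for even \<open>k\<close>, and then the odd \<open>F j\<close> are too small to cancel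
  \<open>F 0 + F (n - 1)\<close>.\<close>

section \<open>Minors and alternating forms\<close>

text \<open>No representation is constructed: an exterior power is a space of functions on tuples,
  and every projection, trace and norm is a finite sum of minors of
  \<open>of_bool (x = y) - c\<close>. Tuples may repeat entries, so alternation replaces an ordering
  of the ground set. This form also fits bijections between two different sets, which the induction
  needs: prescribing the value \<open>i'\<close> at \<open>i\<close> leaves bijections from
  \<open>X - {i}\<close> to \<open>Y - {i'}\<close>. A common sign is imposed because the power of
  degree \<open>n - 1\<close> is the sign character, so that all its traces equal \<open>1\<close>;
  \<open>n\<close> is odd so that this degree is even and both extreme terms enter the alternating
  sum with sign plus. In a counterexample, branching bounds \<open>F j\<close> and
  \<open>F (n - 1 - j)\<close> for \<open>2 * j < n\<close> by
  \<open>2 ^ j / (2 * j choose j)\<close> times \<open>\<bar>A\<bar>\<^sup>2\<close>, roughly a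
  geometric decay away from both ends. The exponent starts as \<open>(n - 1) / 2\<close>; the choice
  of a sign costs \<open>1\<close>, and lowering an even \<open>n\<close> to an odd number costs
  \<open>1 / 2\<close>, which leaves \<open>n / 2 - 2\<close>.\<close>

definition minor :: "('a \<Rightarrow> 'b \<Rightarrow> real) \<Rightarrow> 'a list \<Rightarrow> 'b list \<Rightarrow> real" where
  "minor M xs ys = (if length xs = length ys
     then det (mat (length xs) (length xs) (\<lambda>(a, b). M (xs ! a) (ys ! b))) else 0)"

lemma minor_Nil [simp]: "minor M [] [] = 1"
  by (simp add: minor_def)

lemma minor_cong:
  assumes "\<And>x y. x \<in> set xs \<Longrightarrow> y \<in> set ys \<Longrightarrow> M x y = M' x y"
  shows "minor M xs ys = minor M' xs ys"
proof (cases "length xs = length ys")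
  case True
  hence "mat (length xs) (length xs) (\<lambda>(a, b). M (xs ! a) (ys ! b))
      = mat (length xs) (length xs) (\<lambda>(a, b). M' (xs ! a) (ys ! b))"
    using assms by (intro eq_matI) auto
  thus ?thesis using True by (simp add: minor_def)
qed (simp add: minor_def)

lemma minor_map:
  "minor M (map f xs) (map g ys) = minor (\<lambda>x y. M (f x) (g y)) xs ys"
proof (cases "length xs = length ys")
  case True
  hence "mat (length xs) (length xs) (\<lambda>(a, b). M (map f xs ! a) (map g ys ! b))
      = mat (length xs) (length xs) (\<lambda>(a, b). M (f (xs ! a)) (g (ys ! b)))"
    by (intro eq_matI) auto
  thus ?thesis using True by (simp add: minor_def)
qed (simp add: minor_def)

lemma minor_transpose: "minor M xs ys = minor (\<lambda>b a. M a b) ys xs"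
proof (cases "length xs = length ys")
  case True
  hence "minor M xs ys = det (transpose_mat (mat (length xs) (length xs) (\<lambda>(a, b). M (xs ! a) (ys ! b))))"
    unfolding minor_def by (subst det_transpose) auto
  also have "transpose_mat (mat (length xs) (length xs) (\<lambda>(a, b). M (xs ! a) (ys ! b)))
      = mat (length ys) (length ys) (\<lambda>(a, b). M (xs ! b) (ys ! a))"
    using True by (intro eq_matI) auto
  finally show ?thesis using True by (simp add: minor_def)
qed (simp add: minor_def)

lemma minor_swap:
  "minor M (us @ a # b # vs) ys = - minor M (us @ b # a # vs) ys"
proof -
  let ?n = "length us + 2 + length vs"
  let ?A = "mat ?n ?n (\<lambda>(i, j). M ((us @ b # a # vs) ! i) (ys ! j))"
  have "det (swaprows (length us) (Suc (length us)) ?A) = - det ?A"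
    by (rule det_swaprows[where n = ?n]) auto
  moreover have "swaprows (length us) (Suc (length us)) ?A
      = mat ?n ?n (\<lambda>(i, j). M ((us @ a # b # vs) ! i) (ys ! j))"
    by (intro eq_matI) (auto simp: mat_swaprows_def nth_append nth_Cons split: nat.splits)
  ultimately show ?thesis by (cases "length ys = ?n") (simp_all add: minor_def)
qed

lemma minor_Cons:
  assumes "length ys = Suc (length xs)"
  shows "minor M (x # xs) ys
    = (\<Sum>b<length ys. (-1) ^ b * M x (ys ! b) * minor M xs (take b ys @ drop (Suc b) ys))"
proof -
  let ?n = "Suc (length xs)"
  let ?A = "mat ?n ?n (\<lambda>(i, j). M ((x # xs) ! i) (ys ! j))"
  have "det ?A = (\<Sum>j<?n. ?A $$ (0, j) * cofactor ?A 0 j)"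
    by (rule laplace_expansion_row) auto
  also have "\<dots> = (\<Sum>b<?n. (-1) ^ b * M x (ys ! b) * minor M xs (take b ys @ drop (Suc b) ys))"
  proof (rule sum.cong[OF refl])
    fix b assume "b \<in> {..<?n}"
    hence b: "b < ?n" by simp
    have "mat_delete ?A 0 b
        = mat (length xs) (length xs) (\<lambda>(i, j). M (xs ! i) ((take b ys @ drop (Suc b) ys) ! j))"
      using b assms by (intro eq_matI) (auto simp: mat_delete_def nth_append)
    thus "?A $$ (0, b) * cofactor ?A 0 b
        = (-1) ^ b * M x (ys ! b) * minor M xs (take b ys @ drop (Suc b) ys)"
      using b assms by (simp add: cofactor_def minor_def min_def)
  qed
  finally show ?thesis using assms by (simp add: minor_def)
qed

lemma minor_column_sum:
  assumes "\<And>x. x \<in> set xs \<Longrightarrow> (\<Sum>t\<in>S. v t * M x (h t)) = M x k"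
  shows "(\<Sum>t\<in>S. v t * minor M xs (h t # ys)) = minor M xs (k # ys)"
proof (cases "length xs = Suc (length ys)")
  case True
  have expand: "minor M xs (y # ys)
      = (\<Sum>b<length xs. (-1) ^ b * M (xs ! b) y * minor (\<lambda>b a. M a b) ys (take b xs @ drop (Suc b) xs))" for y
    by (subst minor_transpose) (rule minor_Cons[OF True])
  have "(\<Sum>t\<in>S. v t * minor M xs (h t # ys)) = (\<Sum>b<length xs. (-1) ^ b * (\<Sum>t\<in>S. v t * M (xs ! b) (h t))
      * minor (\<lambda>b a. M a b) ys (take b xs @ drop (Suc b) xs))"
    unfolding expand sum_distrib_left sum_distrib_right by (subst sum.swap) (simp add: mult_ac)
  thus ?thesis using assms by (simp add: expand)
qed (simp add: minor_def)

definition alternating :: "('a list \<Rightarrow> real) \<Rightarrow> bool" where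
  "alternating f \<longleftrightarrow> (\<forall>us a b vs. f (us @ a # b # vs) = - f (us @ b # a # vs))"

lemma alternating_minor_left: "alternating (\<lambda>xs. minor M xs ys)"
  unfolding alternating_def by (blast intro: minor_swap)

lemma alternating_minor_right: "alternating (minor M xs)"
  using alternating_minor_left[of "\<lambda>b a. M a b" xs]
  by (simp add: minor_transpose[of M xs, abs_def])

lemma alternating_Cons: "alternating f \<Longrightarrow> alternating (\<lambda>xs. f (x # xs))"
  unfolding alternating_def by (metis append_Cons)

lemma alternating_Cons_Cons: "alternating f \<Longrightarrow> f (a # b # vs) = - f (b # a # vs)"
  unfolding alternating_def by (metis append_Nil)

lemma alternating_map: "alternating f \<Longrightarrow> alternating (\<lambda>xs. f (map h xs))"
  unfolding alternating_def map_append list.map by blast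

lemma alternating_move:
  assumes "alternating f"
  shows "f (us @ y # vs) = (-1) ^ length us * f (y # us @ vs)"
  using assms
proof (induction us arbitrary: f)
  case (Cons u us)
  have "f ((u # us) @ y # vs) = (-1) ^ length us * f (u # y # us @ vs)"
    using Cons.IH[OF alternating_Cons[OF Cons.prems, of u]] by simp
  thus ?case using alternating_Cons_Cons[OF Cons.prems, of u y] by simp
qed simp

lemma alternating_not_distinct:
  assumes "alternating f" "\<not> distinct xs"
  shows "f xs = 0"
proof -
  obtain us vs ws y where xs: "xs = us @ [y] @ vs @ [y] @ ws"
    using not_distinct_decomp[OF assms(2)] by blast
  have *: "f (us @ y # vs @ y # ws) = (-1) ^ length vs * f (us @ y # y # vs @ ws)"
    using alternating_move[of "\<lambda>zs. f (us @ y # zs)" vs y ws] assms(1)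
    unfolding alternating_def by (metis append.assoc append_Cons)
  have "f (us @ y # y # vs @ ws) = - f (us @ y # y # vs @ ws)"
    using assms(1) unfolding alternating_def by blast
  thus ?thesis using * xs by simp
qed

section \<open>Sums over tuples\<close>

definition tuples :: "nat \<Rightarrow> 'a set \<Rightarrow> 'a list set" where
  "tuples j S = {xs. set xs \<subseteq> S \<and> length xs = j}"

lemma finite_tuples [simp]: "finite S \<Longrightarrow> finite (tuples j S)"
  by (simp add: tuples_def finite_lists_length_eq)

lemma tuples_0 [simp]: "tuples 0 S = {[]}"
  by (auto simp: tuples_def)

lemma map_in_tuples: "xs \<in> tuples j S \<Longrightarrow> f ` S \<subseteq> T \<Longrightarrow> map f xs \<in> tuples j T"
  by (auto simp: tuples_def)

text \<open>A Laplace expansion deletes the entry at some position \<open>b\<close>; this reindexing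
  isolates exactly that entry, so that the expansion can be summed term by term.\<close>

lemma sum_tuples_insert:
  assumes "b \<le> j"
  shows "(\<Sum>z\<in>tuples (Suc j) S. G z) = (\<Sum>z\<in>tuples j S. \<Sum>y\<in>S. G (take b z @ y # drop b z))"
proof -
  have "(\<Sum>z\<in>tuples j S. \<Sum>y\<in>S. G (take b z @ y # drop b z))
      = (\<Sum>(z, y)\<in>tuples j S \<times> S. G (take b z @ y # drop b z))"
    by (simp add: sum.cartesian_product)
  also have "\<dots> = (\<Sum>z\<in>tuples (Suc j) S. G z)"
  proof (rule sum.reindex_bij_witness[where i = "\<lambda>z. (take b z @ drop (Suc b) z, z ! b)"
        and j = "\<lambda>(z, y). take b z @ y # drop b z"])
    fix z assume "z \<in> tuples (Suc j) S"
    hence z: "b < length z" "length z = Suc j" "set z \<subseteq> S" using assms by (auto simp: tuples_def)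
    show "(case (take b z @ drop (Suc b) z, z ! b) of (z, y) \<Rightarrow> take b z @ y # drop b z) = z"
      using z by (simp add: id_take_nth_drop[symmetric])
    have "set (take b z) \<subseteq> S" "set (drop (Suc b) z) \<subseteq> S" "z ! b \<in> S"
      using z set_take_subset[of b z] set_drop_subset[of "Suc b" z] nth_mem[of b z] by blast+
    thus "(take b z @ drop (Suc b) z, z ! b) \<in> tuples j S \<times> S"
      using z by (simp add: tuples_def)
  next
    fix p assume "p \<in> tuples j S \<times> S"
    then obtain z y where p: "p = (z, y)" "length z = j" "set z \<subseteq> S" "y \<in> S"
      by (auto simp: tuples_def)
    have "set (take b z) \<subseteq> S" "set (drop b z) \<subseteq> S"
      using p set_take_subset[of b z] set_drop_subset[of b z] by blast+
    thus "(case p of (z, y) \<Rightarrow> take b z @ y # drop b z) \<in> tuples (Suc j) S"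
      using p assms by (simp add: tuples_def)
    show "(take b (case p of (z, y) \<Rightarrow> take b z @ y # drop b z) @
         drop (Suc b) (case p of (z, y) \<Rightarrow> take b z @ y # drop b z),
         (case p of (z, y) \<Rightarrow> take b z @ y # drop b z) ! b) = p"
      using p assms by (simp add: nth_append min_def Suc_diff_le)
  qed (simp split: prod.split)
  finally show ?thesis ..
qed

lemma sum_tuples_Suc:
  "(\<Sum>z\<in>tuples (Suc j) S. G z) = (\<Sum>z\<in>tuples j S. \<Sum>y\<in>S. G (y # z))"
  using sum_tuples_insert[of 0 j G S] by simp

lemma sum_tuples_map:
  assumes "bij_betw f S T"
  shows "(\<Sum>z\<in>tuples j T. G z) = (\<Sum>z\<in>tuples j S. G (map f z))"
proof -
  have "inj_on (map f) (tuples j S)"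
    using assms
    by (intro inj_on_mapI, elim bij_betw_imp_inj_on[THEN inj_on_subset]) (auto simp: tuples_def)
  moreover have "map f ` tuples j S = tuples j T"
  proof
    show "map f ` tuples j S \<subseteq> tuples j T"
      using map_in_tuples[of _ j S f T] assms by (auto simp: bij_betw_def)
    show "tuples j T \<subseteq> map f ` tuples j S"
    proof
      fix z assume z: "z \<in> tuples j T"
      moreover have "f ` S = T" using assms by (simp add: bij_betw_def)
      ultimately have "z \<in> lists (f ` S)" by (simp only: in_lists_conv_set) (auto simp: tuples_def)
      then obtain x where x: "x \<in> lists S" "z = map f x" unfolding lists_image by blast
      hence "x \<in> tuples j S" using z by (simp add: tuples_def lists_eq_set)
      thus "z \<in> map f ` tuples j S" using x(2) by blast
    qed
  qed
  ultimately have "bij_betw (map f) (tuples j S) (tuples j T)" by (simp add: bij_betw_def)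
  thus ?thesis by (rule sum.reindex_bij_betw[symmetric])
qed

section \<open>Exterior powers of the standard representation\<close>

text \<open>For \<open>c = 1 / card S\<close> the matrix \<open>of_bool (x = y) - c\<close> is the orthogonal projection of \<open>\<real>\<^sup>S\<close> onto the
  standard representation, so \<open>kern c / fact j\<close> is the kernel of the projection of functions on
  \<open>j\<close>-tuples onto its \<open>j\<close>-th exterior power, the alternating forms with \<open>zero_sum\<close>.\<close>

definition kern :: "real \<Rightarrow> 'a list \<Rightarrow> 'a list \<Rightarrow> real" where
  "kern c = minor (\<lambda>x y. of_bool (x = y) - c)"

lemma kern_Nil [simp]: "kern c [] [] = 1"
  by (simp add: kern_def)

lemma kern_sym: "kern c xs ys = kern c ys xs"
  unfolding kern_def by (subst minor_transpose) (simp add: eq_commute)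

lemma alternating_kern_left: "alternating (\<lambda>xs. kern c xs ys)"
  unfolding kern_def by (rule alternating_minor_left)

lemma alternating_kern_right: "alternating (kern c xs)"
  unfolding kern_def by (rule alternating_minor_right)

lemma kern_map:
  assumes "inj_on f S" "set xs \<subseteq> S" "set ys \<subseteq> S"
  shows "kern c (map f xs) (map f ys) = kern c xs ys"
  unfolding kern_def minor_map using assms
  by (intro minor_cong) (auto simp: inj_on_eq_iff subset_iff)

text \<open>Contraction with the all-ones vector annihilates the form, which confines an alternating
  form to the exterior power of the standard representation. Only the first argument is mentioned;
  alternation carries the condition to the others.\<close>

definition zero_sum :: "'a set \<Rightarrow> ('a list \<Rightarrow> real) \<Rightarrow> bool" where
  "zero_sum S f \<longleftrightarrow> (\<forall>vs. set vs \<subseteq> S \<longrightarrow> (\<Sum>y\<in>S. f (y # vs)) = 0)"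

lemma zero_sum_Cons:
  assumes "alternating f" "zero_sum S f" "x \<in> S"
  shows "zero_sum S (\<lambda>xs. f (x # xs))"
  unfolding zero_sum_def
proof (intro allI impI)
  fix vs assume "set vs \<subseteq> S"
  have "(\<Sum>y\<in>S. f (x # y # vs)) = - (\<Sum>y\<in>S. f (y # x # vs))"
    unfolding sum_negf[symmetric] by (intro sum.cong refl alternating_Cons_Cons assms)
  also have "\<dots> = 0" using assms \<open>set vs \<subseteq> S\<close> by (simp add: zero_sum_def)
  finally show "(\<Sum>y\<in>S. f (x # y # vs)) = 0" .
qed

lemma zero_sum_kern_left:
  assumes "finite S" "S \<noteq> {}" "c = 1 / card S" "set ys \<subseteq> S"
  shows "zero_sum S (\<lambda>xs. kern c xs ys)"
  unfolding zero_sum_def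
proof (intro allI impI)
  fix vs assume vs: "set vs \<subseteq> S"
  show "(\<Sum>y\<in>S. kern c (y # vs) ys) = 0"
  proof (cases "length ys = Suc (length vs)")
    case True
    have z: "(\<Sum>y\<in>S. of_bool (y = b) - c) = 0" if "b \<in> S" for b
      using assms that by (simp add: sum_subtractf of_bool_def sum.delta)
    have "(\<Sum>y\<in>S. kern c (y # vs) ys) = (\<Sum>b<length ys. (-1) ^ b * (\<Sum>y\<in>S. of_bool (y = ys ! b) - c)
        * kern c vs (take b ys @ drop (Suc b) ys))"
      unfolding kern_def minor_Cons[OF True] sum_distrib_left sum_distrib_right
      by (rule sum.swap)
    also have "\<dots> = 0"
      by (intro sum.neutral ballI) (use assms(4) in \<open>simp add: z subset_iff\<close>)
    finally show ?thesis .
  qed (simp add: kern_def minor_def)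
qed

lemma zero_sum_kern_right:
  assumes "finite S" "S \<noteq> {}" "c = 1 / card S" "set xs \<subseteq> S"
  shows "zero_sum S (kern c xs)"
  using zero_sum_kern_left[OF assms] by (simp add: kern_sym[of c xs, abs_def])

text \<open>In the Laplace expansion along the first row, the entry at position \<open>b\<close> is
  moved to the front of \<open>f\<close>: the delta part evaluates \<open>f\<close> at
  \<open>i\<close>, and the part with \<open>c\<close> dies by \<open>zero_sum\<close>. All
  positions contribute alike, whence the factor \<open>Suc j\<close> in each step.\<close>

lemma kern_reproducing:
  assumes "finite S" "alternating f" "zero_sum S f" "w \<in> tuples j S"
  shows "(\<Sum>z\<in>tuples j S. kern c w z * f z) = fact j * f w"
  using assms(2-)
proof (induction j arbitrary: w f)
  case (Suc j)
  then obtain i v where w: "w = i # v" "i \<in> S" "v \<in> tuples j S"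
    by (cases w) (auto simp: tuples_def)
  have one: "(\<Sum>z\<in>tuples (Suc j) S. (-1) ^ b * (of_bool (i = z ! b) - c) * kern c v (take b z @ drop (Suc b) z) * f z)
      = fact j * f w" if b: "b \<le> j" for b
  proof -
    have "(\<Sum>z\<in>tuples (Suc j) S. (-1) ^ b * (of_bool (i = z ! b) - c) * kern c v (take b z @ drop (Suc b) z) * f z)
       = (\<Sum>z\<in>tuples j S. kern c v z * (\<Sum>y\<in>S. (of_bool (i = y) - c) * f (y # z)))"
      unfolding sum_tuples_insert[OF b] sum_distrib_left
    proof (intro sum.cong refl)
      fix z y assume z: "z \<in> tuples j S" and "y \<in> S"
      let ?z = "take b z @ y # drop b z"
      have len: "length z = j" using z by (simp add: tuples_def)
      have "f ?z = (-1) ^ b * f (y # z)"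
        using alternating_move[OF Suc.prems(1), of "take b z" y "drop b z"] b len by simp
      moreover have "?z ! b = y" "take b ?z @ drop (Suc b) ?z = z"
        using b len by (simp_all add: nth_append min_def)
      ultimately show "(-1) ^ b * (of_bool (i = ?z ! b) - c) * kern c v (take b ?z @ drop (Suc b) ?z) * f ?z
          = kern c v z * ((of_bool (i = y) - c) * f (y # z))"
        by (simp add: power_mult_distrib[symmetric])
    qed
    also have "\<dots> = (\<Sum>z\<in>tuples j S. kern c v z * f (i # z))"
    proof (intro sum.cong refl arg_cong2[of _ _ _ _ "(*)"])
      fix z assume z: "z \<in> tuples j S"
      have "(\<Sum>y\<in>S. (of_bool (i = y) - c) * f (y # z)) = (\<Sum>y\<in>S. of_bool (i = y) * f (y # z)) - c * (\<Sum>y\<in>S. f (y # z))"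
        by (simp add: left_diff_distrib sum_subtractf sum_distrib_left)
      also have "\<dots> = f (i # z)"
        using z Suc.prems(2) w(2) assms(1) by (simp add: zero_sum_def tuples_def)
      finally show "(\<Sum>y\<in>S. (of_bool (i = y) - c) * f (y # z)) = f (i # z)" .
    qed
    also have "\<dots> = fact j * f (i # v)"
      using Suc.IH[OF alternating_Cons zero_sum_Cons w(3), of f i] Suc.prems w(2) by simp
    finally show ?thesis using w(1) by simp
  qed
  have "(\<Sum>z\<in>tuples (Suc j) S. kern c w z * f z)
      = (\<Sum>z\<in>tuples (Suc j) S. \<Sum>b\<le>j. (-1) ^ b * (of_bool (i = z ! b) - c) * kern c v (take b z @ drop (Suc b) z) * f z)"
  proof (intro sum.cong refl)
    fix z assume "z \<in> tuples (Suc j) S"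
    hence "length z = Suc (length v)" "length z = Suc j" using w(3) by (auto simp: tuples_def)
    thus "kern c w z * f z = (\<Sum>b\<le>j. (-1) ^ b * (of_bool (i = z ! b) - c) * kern c v (take b z @ drop (Suc b) z) * f z)"
      by (simp add: kern_def w(1) minor_Cons sum_distrib_right lessThan_Suc_atMost)
  qed
  also have "\<dots> = (\<Sum>b\<le>j. fact j * f w)"
    unfolding sum.swap[of _ "{..j}"] by (intro sum.cong refl one) simp
  finally show ?case by (simp add: algebra_simps)
qed simp

text \<open>A Schur complement. If \<open>c = 1 / card S\<close>, then \<open>c / (1 - c) = 1 / (card S - 1)\<close> is the constant
  belonging to \<open>S - {i}\<close>.\<close>

lemma kern_Cons_same:
  assumes "c \<noteq> 1" "i \<notin> set xs" "i \<notin> set ys"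
  shows "kern c (i # xs) (i # ys) = (1 - c) * kern (c / (1 - c)) xs ys"
proof (cases "length xs = length ys")
  case True
  define n where "n = length xs"
  define d where "d = c / (1 - c)"
  have d: "d * (1 - c) = c" using assms(1) by (simp add: d_def)
  let ?K = "mat (Suc n) (Suc n) (\<lambda>(a, b). of_bool ((i # xs) ! a = (i # ys) ! b) - c)"
  \<comment> \<open>Block elimination: \<open>?L\<close> subtracts \<open>d\<close> times the first
    row of \<open>?U\<close> from all other rows. The relation \<open>d * (1 - c) = c\<close>
    produces the constant \<open>- c\<close> in the first column and, as \<open>c * d - d\<close>,
    in the remaining ones.\<close>
  let ?L = "mat (Suc n) (Suc n) (\<lambda>(a, b). if a = b then 1 else if b = 0 then - d else 0)"
  let ?U = "mat (Suc n) (Suc n) (\<lambda>(a, b). if a = 0 then (if b = 0 then 1 - c else - c)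
      else if b = 0 then 0 else of_bool (xs ! (a - 1) = ys ! (b - 1)) - d)"
  have neq: "xs ! a \<noteq> i" "i \<noteq> ys ! a" if "a < n" for a
    using assms True that by (auto simp: n_def in_set_conv_nth)
  have "?K = ?L * ?U"
  proof (rule eq_matI)
    fix a b assume "a < dim_row (?L * ?U)" "b < dim_col (?L * ?U)"
    hence ab: "a < Suc n" "b < Suc n" by simp_all
    have "(?L * ?U) $$ (a, b) = (\<Sum>k<Suc n. ?L $$ (a, k) * ?U $$ (k, b))"
      using ab by (simp add: scalar_prod_def lessThan_atLeast0)
    also have "\<dots> = (\<Sum>k\<in>{0, a}. ?L $$ (a, k) * ?U $$ (k, b))"
      using ab by (intro sum.mono_neutral_right) auto
    also have "\<dots> = ?K $$ (a, b)"
      using ab neq d by (cases a; cases b) (auto simp: algebra_simps)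
    finally show "?K $$ (a, b) = (?L * ?U) $$ (a, b)" ..
  qed simp_all
  moreover have "det (?L * ?U) = det ?L * det ?U"
    by (rule det_mult) auto
  moreover have "det ?L = 1"
  proof -
    have "det ?L = prod_list (diag_mat ?L)"
      by (rule det_lower_triangular[where n = "Suc n"]) auto
    also have "diag_mat ?L = replicate (Suc n) 1"
      by (intro nth_equalityI) (auto simp: diag_mat_def simp del: upt_Suc replicate_Suc)
    also have "prod_list (replicate k (1::real)) = 1" for k by (induction k) simp_all
    finally show ?thesis .
  qed
  moreover have "det ?U = (1 - c) * kern d xs ys"
  proof -
    have "det ?U = (\<Sum>a<Suc n. ?U $$ (a, 0) * cofactor ?U a 0)"
      by (rule laplace_expansion_column) auto
    also have "\<dots> = (\<Sum>a\<in>{0}. ?U $$ (a, 0) * cofactor ?U a 0)"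
      by (intro sum.mono_neutral_right) auto
    also have "\<dots> = (1 - c) * det (mat_delete ?U 0 0)" by (simp add: cofactor_def)
    also have "mat_delete ?U 0 0 = mat n n (\<lambda>(a, b). of_bool (xs ! a = ys ! b) - d)"
      by (intro eq_matI) (auto simp: mat_delete_def)
    finally show ?thesis using True by (simp add: kern_def minor_def n_def d_def)
  qed
  moreover have "kern c (i # xs) (i # ys) = det ?K"
    using True by (simp add: kern_def minor_def n_def)
  ultimately show ?thesis by (simp add: d_def)
qed (simp add: kern_def minor_def)

text \<open>Fixing the first argument \<open>b\<close> passes to \<open>S - {b}\<close>: tuples
  through \<open>b\<close> vanish, the Schur complement contributes the factor \<open>1 - c\<close>,
  and \<open>g (b # _)\<close> still has zero sums over \<open>S - {b}\<close> because its term at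
  \<open>b\<close> is zero.\<close>

lemma kern_reproducing_Cons:
  assumes "finite S" "card S \<ge> 2" "c = 1 / card S" "b \<in> S"
    and g: "alternating g" "zero_sum S g" and w: "w \<in> tuples j S"
  shows "(\<Sum>z\<in>tuples j S. kern c (b # w) (b # z) * g (b # z)) = fact j * (1 - c) * g (b # w)"
proof (cases "b \<in> set w")
  case True
  hence "\<not> distinct (b # w)" by simp
  hence "kern c (b # w) z = 0" "g (b # w) = 0" for z
    using alternating_not_distinct alternating_kern_left g(1) by fast+
  thus ?thesis by simp
next
  case False
  let ?S = "S - {b}"
  have c: "c \<noteq> 1" "c / (1 - c) = 1 / card ?S"
    using assms(1-4) by (auto simp: of_nat_diff field_simps)
  have nd: "g (b # z) = 0" if "b \<in> set z" for z
    using alternating_not_distinct[OF g(1), of "b # z"] that by simp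
  have "(\<Sum>z\<in>tuples j S. kern c (b # w) (b # z) * g (b # z))
      = (\<Sum>z\<in>tuples j ?S. kern c (b # w) (b # z) * g (b # z))"
    using assms(1) by (intro sum.mono_neutral_right) (auto simp: tuples_def nd finite_lists_length_eq)
  also have "\<dots> = (1 - c) * (\<Sum>z\<in>tuples j ?S. kern (c / (1 - c)) w z * g (b # z))"
    unfolding sum_distrib_left using False c
    by (intro sum.cong refl) (subst kern_Cons_same, auto simp: tuples_def)
  also have "(\<Sum>z\<in>tuples j ?S. kern (c / (1 - c)) w z * g (b # z)) = fact j * g (b # w)"
  proof (rule kern_reproducing)
    show "alternating (\<lambda>z. g (b # z))" by (rule alternating_Cons[OF g(1)])
    show "zero_sum ?S (\<lambda>z. g (b # z))"
      unfolding zero_sum_def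
    proof (intro allI impI)
      fix vs assume "set vs \<subseteq> ?S"
      hence "(\<Sum>y\<in>S. g (b # y # vs)) = 0"
        using zero_sum_Cons[OF g assms(4)] by (auto simp: zero_sum_def)
      moreover have "g (b # b # vs) = 0" using nd by simp
      ultimately show "(\<Sum>y\<in>?S. g (b # y # vs)) = 0"
        using assms(1,4) by (simp add: sum_diff1)
    qed
    show "w \<in> tuples j ?S" using w False by (auto simp: tuples_def)
  qed (use assms in simp)
  finally show ?thesis by simp
qed

text \<open>A partial trace. In the expansion along the first row, the diagonal entry contributes
  the factor \<open>card S * (1 - c) = card S - 1\<close>, and each of the \<open>j\<close> other
  positions contributes \<open>-1\<close>, since the sum over \<open>i\<close> puts
  \<open>z' ! b\<close> back into its place up to sign.\<close>

lemma kern_contract: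
  assumes "finite S" "S \<noteq> {}" "c = 1 / card S" and z: "z \<in> tuples j S" "z' \<in> tuples j S"
  shows "(\<Sum>i\<in>S. kern c (i # z) (i # z')) = (real (card S) - 1 - j) * kern c z z'"
proof -
  have len: "length z = j" "length z' = j" "set z \<subseteq> S" "set z' \<subseteq> S" using z by (auto simp: tuples_def)
  have one: "(\<Sum>i\<in>S. (-1) ^ Suc b * (of_bool (i = z' ! b) - c) * kern c z (i # take b z' @ drop (Suc b) z'))
      = - kern c z z'" if b: "b < j" for b
  proof -
    let ?r = "take b z' @ drop (Suc b) z'"
    have zb: "z' ! b \<in> S" using b len by auto
    have r: "set ?r \<subseteq> S" using len by (auto dest: in_set_takeD in_set_dropD)
    have "(\<Sum>i\<in>S. (of_bool (i = z' ! b) - c) * kern c z (i # ?r))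
        = (\<Sum>i\<in>S. of_bool (i = z' ! b) * kern c z (i # ?r)) - c * (\<Sum>i\<in>S. kern c z (i # ?r))"
      by (simp add: left_diff_distrib sum_subtractf sum_distrib_left)
    also have "\<dots> = kern c z (z' ! b # ?r)"
      using zero_sum_kern_right[OF assms(1-3) len(3)] r zb assms(1) by (simp add: zero_sum_def)
    also have "\<dots> = (-1) ^ b * kern c z z'"
      using alternating_move[OF alternating_kern_right, of c z "take b z'" "z' ! b" "drop (Suc b) z'"]
        b len by (simp add: id_take_nth_drop[symmetric] power_mult_distrib[symmetric])
    finally show ?thesis
      by (simp add: mult.assoc sum_distrib_left[symmetric] sum_negf power_mult_distrib[symmetric])
  qed
  have "kern c (i # z) (i # z') = (1 - c) * kern c z z'
      + (\<Sum>b<j. (-1) ^ Suc b * (of_bool (i = z' ! b) - c) * kern c z (i # take b z' @ drop (Suc b) z'))" for i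
    unfolding kern_def by (subst minor_Cons) (simp_all add: len sum.lessThan_Suc_shift del: sum.lessThan_Suc)
  hence "(\<Sum>i\<in>S. kern c (i # z) (i # z')) = card S * ((1 - c) * kern c z z') + (\<Sum>b<j. - kern c z z')"
    by (simp add: sum.distrib sum.swap[of _ "{..<j}"] one del: power_Suc)
  also have "\<dots> = card S * (1 - c) * kern c z z' - j * kern c z z'" by simp
  also have "card S * (1 - c) = real (card S) - 1" using assms by (simp add: field_simps)
  finally show ?thesis by (simp add: left_diff_distrib)
qed

section \<open>The branching inequality\<close>

lemma sum_product_swap:
  "(\<Sum>z\<in>T. (\<Sum>w\<in>A. f w z) * (\<Sum>w'\<in>B. g w' z))
    = (\<Sum>w\<in>A. \<Sum>w'\<in>B. \<Sum>z\<in>T. f w z * (g w' z :: real))"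
  unfolding sum_product by (subst sum.swap, rule sum.cong[OF refl], rule sum.swap)

lemma sum_of_bool_mult:
  assumes "finite S" "a \<in> S"
  shows "(\<Sum>b\<in>S. \<Sum>z\<in>T. of_bool (a = b) * h b z) = (\<Sum>z\<in>T. h a z :: real)"
  using assms by (simp add: sum_distrib_left[symmetric])

text \<open>Up to a factor, the projection onto the copy of the \<open>j\<close>-th exterior power over \<open>S\<close> in the sum,
  over \<open>a \<in> S\<close>, of the \<open>j\<close>-th exterior powers over \<open>S - {a}\<close>. The copy of the \<open>(j + 1)\<close>-st
  exterior power, embedded by contraction, has projection kernel \<open>kern\<close>.\<close>

definition lift_kern :: "real \<Rightarrow> nat \<Rightarrow> 'a set \<Rightarrow> 'a \<Rightarrow> 'a list \<Rightarrow> 'a \<Rightarrow> 'a list \<Rightarrow> real" where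
  "lift_kern c j S a u b z = (\<Sum>w\<in>tuples j S. kern c (a # u) (a # w) * kern c (b # z) (b # w))"

lemma lift_kern_sym: "lift_kern c j S a u b z = lift_kern c j S b z a u"
  by (simp add: lift_kern_def mult.commute)

section \<open>Inner products of the three kernels behind the branching rule\<close>

context
  fixes S :: "'a set" and c :: real and j :: nat
  assumes S: "finite S" "card S \<ge> 2" and c: "c = 1 / card S"
begin

lemma S_nonempty: "S \<noteq> {}"
  using S by auto

lemma kern_form_right:
  assumes "set v \<subseteq> S"
  shows "alternating (kern c v)" "zero_sum S (kern c v)"
  using alternating_kern_right zero_sum_kern_right[OF S(1) S_nonempty c assms] by auto

lemma kern_form_left:
  assumes "set v \<subseteq> S"
  shows "alternating (\<lambda>x. kern c x v)" "zero_sum S (\<lambda>x. kern c x v)"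
  using alternating_kern_left zero_sum_kern_left[OF S(1) S_nonempty c assms] by auto

text \<open>With the lemmas that follow, this gives the inner products over all
  \<open>(b, z)\<close> of three kernels: the block-diagonal one, \<open>kern\<close> and
  \<open>lift_kern\<close>. Each is a multiple of a projection, and the first acts as a scalar on
  the ranges of the other two.\<close>

lemma gram_kern_kern:
  assumes "a \<in> S" "u \<in> tuples j S" "v \<in> tuples (Suc j) S"
  shows "(\<Sum>b\<in>S. \<Sum>z\<in>tuples j S. kern c (a # u) (b # z) * kern c v (b # z)) = fact (Suc j) * kern c (a # u) v"
proof -
  have "(\<Sum>b\<in>S. \<Sum>z\<in>tuples j S. kern c (a # u) (b # z) * kern c v (b # z))
      = (\<Sum>z\<in>tuples (Suc j) S. kern c v z * kern c (a # u) z)"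
    unfolding sum_tuples_Suc by (subst sum.swap) (simp add: mult.commute)
  also have "\<dots> = fact (Suc j) * kern c (a # u) v"
    using assms by (intro kern_reproducing kern_form_right S) (auto simp: tuples_def)
  finally show ?thesis .
qed

lemma gram_delta_form:
  assumes "a \<in> S" "u \<in> tuples j S" "alternating g" "zero_sum S g"
  shows "(\<Sum>b\<in>S. \<Sum>z\<in>tuples j S. of_bool (a = b) * kern c (a # u) (b # z) * g (b # z))
    = fact j * (1 - c) * g (a # u)"
proof -
  have "(\<Sum>b\<in>S. \<Sum>z\<in>tuples j S. of_bool (a = b) * kern c (a # u) (b # z) * g (b # z))
      = (\<Sum>z\<in>tuples j S. kern c (a # u) (a # z) * g (a # z))"
    using sum_of_bool_mult[OF S(1) assms(1), where T = "tuples j S" and h = "\<lambda>b z. kern c (a # u) (b # z) * g (b # z)"]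
    by (simp add: mult.assoc)
  also have "\<dots> = fact j * (1 - c) * g (a # u)"
    by (rule kern_reproducing_Cons[OF S c]) (use assms in auto)
  finally show ?thesis .
qed

lemma gram_delta_lift:
  assumes "a \<in> S" "u \<in> tuples j S" "a' \<in> S" "u' \<in> tuples j S"
  shows "(\<Sum>b\<in>S. \<Sum>z\<in>tuples j S. of_bool (a = b) * kern c (a # u) (b # z) * lift_kern c j S a' u' b z)
    = fact j * (1 - c) * lift_kern c j S a u a' u'"
proof -
  have "(\<Sum>b\<in>S. \<Sum>z\<in>tuples j S. of_bool (a = b) * kern c (a # u) (b # z) * lift_kern c j S a' u' b z)
      = (\<Sum>z\<in>tuples j S. kern c (a # u) (a # z) * lift_kern c j S a' u' a z)"
    using sum_of_bool_mult[OF S(1) assms(1), where T = "tuples j S" and h = "\<lambda>b z. kern c (a # u) (b # z) * lift_kern c j S a' u' b z"]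
    by (simp add: mult.assoc)
  also have "\<dots> = (\<Sum>w\<in>tuples j S. kern c (a' # u') (a' # w)
      * (\<Sum>z\<in>tuples j S. kern c (a # u) (a # z) * kern c (a # z) (a # w)))"
    unfolding lift_kern_def sum_distrib_left by (subst sum.swap) (simp add: mult_ac)
  also have "\<dots> = (\<Sum>w\<in>tuples j S. kern c (a' # u') (a' # w) * (fact j * (1 - c) * kern c (a # u) (a # w)))"
  proof (intro sum.cong refl arg_cong2[of _ _ _ _ "(*)"])
    fix w assume "w \<in> tuples j S"
    thus "(\<Sum>z\<in>tuples j S. kern c (a # u) (a # z) * kern c (a # z) (a # w))
        = fact j * (1 - c) * kern c (a # u) (a # w)"
      using assms by (intro kern_reproducing_Cons[OF S c] kern_form_left) (auto simp: tuples_def)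
  qed
  also have "\<dots> = fact j * (1 - c) * lift_kern c j S a u a' u'"
    by (simp add: lift_kern_def sum_distrib_left mult_ac)
  finally show ?thesis .
qed

text \<open>Orthogonality of the two copies: once \<open>z\<close> is summed out, \<open>b\<close>
  survives only in \<open>kern c (a # u) (b # w)\<close>, whose sum over \<open>S\<close>
  vanishes.\<close>

lemma gram_kern_lift:
  assumes "a \<in> S" "u \<in> tuples j S" "a' \<in> S" "u' \<in> tuples j S"
  shows "(\<Sum>b\<in>S. \<Sum>z\<in>tuples j S. kern c (a # u) (b # z) * lift_kern c j S a' u' b z) = 0"
proof -
  have "(\<Sum>b\<in>S. \<Sum>z\<in>tuples j S. kern c (a # u) (b # z) * lift_kern c j S a' u' b z)
      = (\<Sum>b\<in>S. \<Sum>w\<in>tuples j S. kern c (a' # u') (a' # w)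
        * (\<Sum>z\<in>tuples j S. kern c (b # w) (b # z) * kern c (a # u) (b # z)))"
    unfolding lift_kern_def sum_distrib_left
    by (rule sum.cong[OF refl], subst sum.swap) (simp add: mult_ac kern_sym)
  also have "\<dots> = (\<Sum>b\<in>S. \<Sum>w\<in>tuples j S. kern c (a' # u') (a' # w) * (fact j * (1 - c) * kern c (a # u) (b # w)))"
  proof (intro sum.cong refl arg_cong2[of _ _ _ _ "(*)"])
    fix b w assume "b \<in> S" "w \<in> tuples j S"
    thus "(\<Sum>z\<in>tuples j S. kern c (b # w) (b # z) * kern c (a # u) (b # z))
        = fact j * (1 - c) * kern c (a # u) (b # w)"
      using assms by (intro kern_reproducing_Cons[OF S c] kern_form_right) (auto simp: tuples_def)
  qed
  also have "\<dots> = (\<Sum>w\<in>tuples j S. fact j * (1 - c) * kern c (a' # u') (a' # w) * (\<Sum>b\<in>S. kern c (a # u) (b # w)))"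
    unfolding sum_distrib_left by (subst sum.swap) (simp add: mult_ac)
  also have "\<dots> = 0"
  proof (intro sum.neutral ballI)
    fix w assume "w \<in> tuples j S"
    hence "(\<Sum>b\<in>S. kern c (a # u) (b # w)) = 0"
      using kern_form_right(2)[of "a # u"] assms by (auto simp: zero_sum_def tuples_def)
    thus "fact j * (1 - c) * kern c (a' # u') (a' # w) * (\<Sum>b\<in>S. kern c (a # u) (b # w)) = 0" by simp
  qed
  finally show ?thesis .
qed

text \<open>Summing out \<open>z\<close> leaves \<open>kern c (b # w) (b # w')\<close>; its partial
  trace over \<open>b\<close> produces the factor \<open>card S - 1 - j\<close> and a kernel in
  \<open>w\<close> and \<open>w'\<close> that reproduces the remaining form.\<close>

lemma gram_lift_lift:
  assumes "a \<in> S" "u \<in> tuples j S" "a' \<in> S" "u' \<in> tuples j S"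
  shows "(\<Sum>b\<in>S. \<Sum>z\<in>tuples j S. lift_kern c j S a u b z * lift_kern c j S a' u' b z)
    = (fact j)\<^sup>2 * (1 - c) * (real (card S) - 1 - j) * lift_kern c j S a u a' u'"
proof -
  let ?k = "kern c" and ?T = "tuples j S"
  have "(\<Sum>b\<in>S. \<Sum>z\<in>?T. lift_kern c j S a u b z * lift_kern c j S a' u' b z)
      = (\<Sum>b\<in>S. \<Sum>w\<in>?T. \<Sum>w'\<in>?T. ?k (a # u) (a # w) * ?k (a' # u') (a' # w')
        * (\<Sum>z\<in>?T. ?k (b # w) (b # z) * ?k (b # z) (b # w')))"
    unfolding lift_kern_def sum_product_swap unfolding sum_distrib_left
    by (simp add: mult_ac kern_sym)
  also have "\<dots> = (\<Sum>b\<in>S. \<Sum>w\<in>?T. \<Sum>w'\<in>?T. ?k (a # u) (a # w) * ?k (a' # u') (a' # w')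
        * (fact j * (1 - c) * ?k (b # w) (b # w')))"
  proof (intro sum.cong refl arg_cong2[of _ _ _ _ "(*)"])
    fix b w w' assume "b \<in> S" "w \<in> ?T" "w' \<in> ?T"
    thus "(\<Sum>z\<in>?T. ?k (b # w) (b # z) * ?k (b # z) (b # w')) = fact j * (1 - c) * ?k (b # w) (b # w')"
      by (intro kern_reproducing_Cons[OF S c] kern_form_left) (auto simp: tuples_def)
  qed
  also have "\<dots> = fact j * (1 - c) * (\<Sum>w\<in>?T. \<Sum>w'\<in>?T. ?k (a # u) (a # w) * ?k (a' # u') (a' # w')
        * (\<Sum>b\<in>S. ?k (b # w) (b # w')))"
    unfolding sum_distrib_left
    by (subst sum.swap, rule sum.cong[OF refl], subst sum.swap) (simp add: mult_ac)
  also have "\<dots> = fact j * (1 - c) * (\<Sum>w\<in>?T. \<Sum>w'\<in>?T. ?k (a # u) (a # w) * ?k (a' # u') (a' # w')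
        * ((real (card S) - 1 - j) * ?k w w'))"
    using kern_contract[OF S(1) S_nonempty c] by simp
  also have "\<dots> = fact j * (1 - c) * (real (card S) - 1 - j) * (\<Sum>w\<in>?T. ?k (a # u) (a # w)
        * (\<Sum>w'\<in>?T. ?k w w' * ?k (a' # u') (a' # w')))"
    unfolding sum_distrib_left by (simp add: mult_ac)
  also have "\<dots> = fact j * (1 - c) * (real (card S) - 1 - j) * (\<Sum>w\<in>?T. ?k (a # u) (a # w)
        * (fact j * ?k (a' # u') (a' # w)))"
  proof (intro sum.cong refl arg_cong2[of _ _ _ _ "(*)"])
    fix w assume "w \<in> ?T"
    moreover have "set (a' # u') \<subseteq> S" using assms by (auto simp: tuples_def)
    ultimately show "(\<Sum>w'\<in>?T. ?k w w' * ?k (a' # u') (a' # w')) = fact j * ?k (a' # u') (a' # w)"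
      using assms by (intro kern_reproducing alternating_Cons zero_sum_Cons kern_form_right S) auto
  qed
  finally show ?thesis
    by (simp add: lift_kern_def sum_distrib_left power2_eq_square mult_ac)
qed

text \<open>The component orthogonal to both copies; that its norm is nonnegative is the branching
  inequality.\<close>

definition residual :: "'a \<Rightarrow> 'a list \<Rightarrow> 'a \<Rightarrow> 'a list \<Rightarrow> real" where
  "residual a u b z = of_bool (a = b) * kern c (a # u) (b # z) - (1 - c) / Suc j * kern c (a # u) (b # z)
     - 1 / (fact j * (real (card S) - 1 - j)) * lift_kern c j S a u b z"

text \<open>With \<open>m = card S - 1 - j\<close>, the coefficients in \<open>residual\<close> are
  the quotients \<open>fact j * (1 - c) / fact (Suc j)\<close> and
  \<open>fact j * (1 - c) / ((fact j)\<^sup>2 * (1 - c) * m)\<close> of the constants found above;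
  they make it orthogonal to \<open>kern\<close> and \<open>lift_kern\<close>. As in Pythagoras'
  theorem, each removed component is then subtracted once.\<close>

lemma gram_residual:
  assumes "a \<in> S" "u \<in> tuples j S" "a' \<in> S" "u' \<in> tuples j S" and m: "real (card S) - 1 - j \<noteq> 0"
  shows "(\<Sum>b\<in>S. \<Sum>z\<in>tuples j S. residual a u b z * residual a' u' b z)
    = fact j * (1 - c) * of_bool (a = a') * kern c (a # u) (a' # u')
      - fact j * (1 - c)\<^sup>2 / Suc j * kern c (a # u) (a' # u')
      - (1 - c) / (real (card S) - 1 - j) * lift_kern c j S a u a' u'"
proof -
  define m where "m = real (card S) - 1 - j"
  have m': "m \<noteq> 0" using m by (simp add: m_def)
  define E where "E h = (\<Sum>b\<in>S. \<Sum>z\<in>tuples j S. h b z)" for h :: "'a \<Rightarrow> 'a list \<Rightarrow> real"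
  define d k l where "d = (\<lambda>(a::'a) u b z. of_bool (a = b) * kern c (a # u) (b # z))"
    and "k = (\<lambda>(a::'a) u b z. kern c (a # u) (b # z))" and "l = lift_kern c j S"
  note defs = d_def k_def l_def E_def
  let ?al = "(1 - c) / Suc j" and ?be = "1 / (fact j * m)"
  have E_add: "E (\<lambda>b z. h b z + h' b z) = E h + E h'" for h h' by (simp add: E_def sum.distrib)
  have E_mult: "E (\<lambda>b z. t * h b z) = t * E h" for h t by (simp add: E_def sum_distrib_left)
  have sets: "set (a # u) \<subseteq> S" "set (a' # u') \<subseteq> S" "a # u \<in> tuples (Suc j) S" "a' # u' \<in> tuples (Suc j) S"
    using assms by (auto simp: tuples_def)
  let ?k = "kern c (a # u) (a' # u')" and ?l = "l a u a' u'"
  have dd: "E (\<lambda>b z. d a u b z * d a' u' b z) = of_bool (a = a') * (fact j * (1 - c) * ?k)"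
  proof -
    have "E (\<lambda>b z. d a u b z * d a' u' b z)
       = of_bool (a = a') * E (\<lambda>b z. d a u b z * k a' u' b z)"
      by (cases "a = a'") (auto simp: defs intro!: sum.cong sum.neutral)
    also have "E (\<lambda>b z. d a u b z * k a' u' b z) = fact j * (1 - c) * ?k"
      using gram_delta_form[OF assms(1,2) kern_form_right[OF sets(2)]] by (simp add: defs kern_sym)
    finally show ?thesis .
  qed
  have dk: "E (\<lambda>b z. d a u b z * k a' u' b z) = fact j * (1 - c) * ?k"
    using gram_delta_form[OF assms(1,2) kern_form_right[OF sets(2)]] by (simp add: defs kern_sym)
  have kd: "E (\<lambda>b z. k a u b z * d a' u' b z) = fact j * (1 - c) * ?k"
    using gram_delta_form[OF assms(3,4) kern_form_right[OF sets(1)]] by (simp add: defs mult_ac)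
  have kk: "E (\<lambda>b z. k a u b z * k a' u' b z) = fact (Suc j) * ?k"
    using gram_kern_kern[OF assms(1,2) sets(4)] by (simp add: defs)
  have dl: "E (\<lambda>b z. d a u b z * l a' u' b z) = fact j * (1 - c) * ?l"
    using gram_delta_lift[OF assms(1-4)] by (simp add: defs)
  have ld: "E (\<lambda>b z. l a u b z * d a' u' b z) = fact j * (1 - c) * ?l"
    using gram_delta_lift[OF assms(3,4,1,2)] lift_kern_sym[of c j S a u a' u'] by (simp add: defs mult_ac)
  have kl: "E (\<lambda>b z. k a u b z * l a' u' b z) = 0"
    using gram_kern_lift[OF assms(1-4)] by (simp add: defs)
  have lk: "E (\<lambda>b z. l a u b z * k a' u' b z) = 0"
    using gram_kern_lift[OF assms(3,4,1,2)] by (simp add: defs mult_ac)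
  have ll: "E (\<lambda>b z. l a u b z * l a' u' b z) = (fact j)\<^sup>2 * (1 - c) * m * ?l"
    using gram_lift_lift[OF assms(1-4)] by (simp add: defs m_def)
  have expand: "(p - s * q - t * r) * (p' - s * q' - t * r') = p * p' + (- s) * (p * q') + (- t) * (p * r')
      + (- s) * (q * p') + s\<^sup>2 * (q * q') + s * t * (q * r')
      + (- t) * (r * p') + s * t * (r * q') + t\<^sup>2 * (r * r')" for p q r p' q' r' s t :: real
    by (simp add: algebra_simps power2_eq_square)
  have "(\<Sum>b\<in>S. \<Sum>z\<in>tuples j S. residual a u b z * residual a' u' b z)
      = E (\<lambda>b z. d a u b z * d a' u' b z + (- ?al) * (d a u b z * k a' u' b z) + (- ?be) * (d a u b z * l a' u' b z)
        + (- ?al) * (k a u b z * d a' u' b z) + ?al\<^sup>2 * (k a u b z * k a' u' b z) + ?al * ?be * (k a u b z * l a' u' b z)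
        + (- ?be) * (l a u b z * d a' u' b z) + ?al * ?be * (l a u b z * k a' u' b z) + ?be\<^sup>2 * (l a u b z * l a' u' b z))"
    unfolding residual_def defs m_def by (intro sum.cong refl expand)
  also have "\<dots> = of_bool (a = a') * (fact j * (1 - c) * ?k) - 2 * ?al * (fact j * (1 - c) * ?k)
      - 2 * ?be * (fact j * (1 - c) * ?l) + ?al\<^sup>2 * (fact (Suc j) * ?k) + ?be\<^sup>2 * ((fact j)\<^sup>2 * (1 - c) * m * ?l)"
    unfolding E_add E_mult dd dk kd kk dl ld kl lk ll by (simp add: algebra_simps)
  also have "?al\<^sup>2 * (fact (Suc j) * ?k) = ?al * (fact j * (1 - c) * ?k)"
    by (simp add: power2_eq_square field_simps del: of_nat_Suc)
  also have "?be\<^sup>2 * ((fact j)\<^sup>2 * (1 - c) * m * ?l) = (1 - c) / m * ?l"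
    using m' by (simp add: power2_eq_square)
  also have "2 * ?be * (fact j * (1 - c) * ?l) = 2 * ((1 - c) / m * ?l)" by simp
  finally show ?thesis by (simp add: m_def l_def power2_eq_square mult_ac)
qed

end

section \<open>Traces, energies and restricted families\<close>

text \<open>The trace of \<open>g\<^sup>-\<^sup>1 \<circ> f\<close> on the \<open>j\<close>-th exterior power of the standard representation.\<close>

definition pair_trace :: "nat \<Rightarrow> 'a set \<Rightarrow> ('a \<Rightarrow> 'b) \<Rightarrow> ('a \<Rightarrow> 'b) \<Rightarrow> real" where
  "pair_trace j X f g = (\<Sum>x\<in>tuples j X. kern (1 / card X) (map f x) (map g x)) / fact j"

text \<open>The \<open>F j\<close> of the overview: expanding the squared norm of the sum over
  \<open>A\<close> gives the traces of all \<open>g\<^sup>-\<^sup>1 \<circ> f\<close>.\<close>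

definition energy :: "nat \<Rightarrow> 'a set \<Rightarrow> ('a \<Rightarrow> 'b) set \<Rightarrow> real" where
  "energy j X A = (\<Sum>f\<in>A. \<Sum>g\<in>A. pair_trace j X f g)"

lemma pair_trace_0 [simp]: "pair_trace 0 X f g = 1"
  by (simp add: pair_trace_def)

lemma energy_0: "energy 0 X A = (real (card A))\<^sup>2"
  by (simp add: energy_def power2_eq_square)

text \<open>The reproducing property splits the kernel into a factor depending on \<open>f\<close>
  and one depending on \<open>g\<close>, so that energies become sums of squares and Cauchy--Schwarz
  applies to traces.\<close>

lemma pair_trace_gram:
  fixes f g :: "'a \<Rightarrow> 'b"
  assumes "finite Y" "Y \<noteq> {}" "bij_betw f X Y" "bij_betw g X Y"
  shows "(fact j)\<^sup>2 * pair_trace j X f g = (\<Sum>x\<in>tuples j X. \<Sum>z\<in>tuples j Y.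
    kern (1 / card Y) (map f x) z * kern (1 / card Y) (map g x) z)"
proof -
  let ?k = "kern (1 / card Y) :: 'b list \<Rightarrow> 'b list \<Rightarrow> real"
  have card: "card X = card Y" using bij_betw_same_card[OF assms(3)] .
  have im: "f ` X = Y" "g ` X = Y" using assms(3,4) by (auto simp: bij_betw_def)
  have rep: "fact j * ?k (map f x) (map g x) = (\<Sum>z\<in>tuples j Y. ?k (map f x) z * ?k (map g x) z)"
    if "x \<in> tuples j X" for x
  proof -
    have "f ` set x \<subseteq> f ` X" "g ` set x \<subseteq> g ` X" using that by (auto simp: tuples_def)
    hence "set (map f x) \<subseteq> Y" "set (map g x) \<subseteq> Y" unfolding im by simp_all
    hence "(\<Sum>z\<in>tuples j Y. ?k (map f x) z * ?k (map g x) z) = fact j * ?k (map g x) (map f x)"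
      using that assms(1,2) by (intro kern_reproducing alternating_kern_right zero_sum_kern_right)
        (simp_all add: tuples_def)
    thus ?thesis by (simp add: kern_sym)
  qed
  have "(fact j)\<^sup>2 * pair_trace j X f g = (\<Sum>x\<in>tuples j X. fact j * ?k (map f x) (map g x))"
    by (simp add: pair_trace_def sum_distrib_left[symmetric] power2_eq_square card)
  also have "\<dots> = (\<Sum>x\<in>tuples j X. \<Sum>z\<in>tuples j Y. ?k (map f x) z * ?k (map g x) z)"
    by (intro sum.cong refl rep)
  finally show ?thesis .
qed

lemma energy_nonneg:
  assumes "finite Y" "Y \<noteq> {}" "\<And>f. f \<in> A \<Longrightarrow> bij_betw f X Y"
  shows "energy j X A \<ge> 0"
proof -
  have "(fact j)\<^sup>2 * energy j X A = (\<Sum>f\<in>A. \<Sum>g\<in>A. \<Sum>x\<in>tuples j X. \<Sum>z\<in>tuples j Y.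
      kern (1 / card Y) (map f x) z * kern (1 / card Y) (map g x) z)"
    unfolding energy_def sum_distrib_left using assms by (intro sum.cong refl pair_trace_gram)
  also have "\<dots> = (\<Sum>x\<in>tuples j X. \<Sum>z\<in>tuples j Y. (\<Sum>f\<in>A. kern (1 / card Y) (map f x) z)\<^sup>2)"
    unfolding power2_eq_square sum_product_swap unfolding sum.swap[of _ "tuples j X" A] ..
  also have "\<dots> \<ge> 0" by (intro sum_nonneg) simp
  finally show ?thesis by (simp add: zero_le_mult_iff)
qed

definition restr :: "('a \<Rightarrow> 'b) set \<Rightarrow> 'a \<Rightarrow> 'b \<Rightarrow> ('a \<Rightarrow> 'b) set" where
  "restr A i i' = {f \<in> A. f i = i'}"

lemma sum_restr:
  assumes "finite A" "finite Y" "\<And>f. f \<in> A \<Longrightarrow> f i \<in> Y"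
  shows "(\<Sum>i'\<in>Y. \<Sum>f\<in>restr A i i'. \<Sum>g\<in>restr A i i'. h f g)
    = (\<Sum>f\<in>A. \<Sum>g\<in>A. of_bool (f i = g i) * (h f g :: real))"
proof -
  have "(\<Sum>i'\<in>Y. \<Sum>f\<in>restr A i i'. \<Sum>g\<in>restr A i i'. h f g)
      = (\<Sum>i'\<in>Y. \<Sum>f\<in>A. \<Sum>g\<in>A. of_bool (i' = f i) * (of_bool (f i = g i) * h f g))"
  proof (rule sum.cong[OF refl])
    fix i'
    have "(\<Sum>f\<in>restr A i i'. \<Sum>g\<in>restr A i i'. h f g)
        = (\<Sum>f\<in>A. of_bool (f i = i') * (\<Sum>g\<in>A. of_bool (g i = i') * h f g))"
      using assms(1) by (simp add: restr_def sum.inter_filter of_bool_def if_distrib if_distribR cong: if_cong)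
    thus "(\<Sum>f\<in>restr A i i'. \<Sum>g\<in>restr A i i'. h f g)
        = (\<Sum>f\<in>A. \<Sum>g\<in>A. of_bool (i' = f i) * (of_bool (f i = g i) * h f g))"
      by (auto simp: sum_distrib_left intro!: sum.cong)
  qed
  also have "\<dots> = (\<Sum>f\<in>A. \<Sum>g\<in>A. \<Sum>i'\<in>Y. of_bool (i' = f i) * (of_bool (f i = g i) * h f g))"
    by (subst sum.swap, rule sum.cong[OF refl], rule sum.swap)
  also have "\<dots> = (\<Sum>f\<in>A. \<Sum>g\<in>A. of_bool (f i = g i) * h f g)"
    using assms by (intro sum.cong refl) (simp add: sum_distrib_right[symmetric])
  finally show ?thesis .
qed

text \<open>Tuples through \<open>i\<close> contribute zero; on the others the common value at
  \<open>i\<close> permits the Schur complement, which turns the kernel for \<open>X\<close> into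
  the one for \<open>X - {i}\<close>.\<close>

lemma pair_trace_restr:
  assumes "finite X" "card X \<ge> 2" "i \<in> X" "inj_on f X" "inj_on g X" "f i = g i"
  shows "(1 - 1 / card X) * fact j * pair_trace j (X - {i}) f g
    = (\<Sum>x\<in>tuples j X. kern (1 / card X) (f i # map f x) (g i # map g x))"
proof -
  let ?c = "1 / card X"
  have c: "?c \<noteq> 1" "?c / (1 - ?c) = 1 / card (X - {i})"
    using assms(1-3) by (auto simp: of_nat_diff field_simps)
  have "(\<Sum>x\<in>tuples j X. kern ?c (f i # map f x) (g i # map g x))
      = (\<Sum>x\<in>tuples j (X - {i}). kern ?c (f i # map f x) (g i # map g x))"
  proof (intro sum.mono_neutral_right ballI)
    fix x assume "x \<in> tuples j X - tuples j (X - {i})"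
    hence "\<not> distinct (f i # map f x)" by (auto simp: tuples_def)
    thus "kern ?c (f i # map f x) (g i # map g x) = 0"
      by (rule alternating_not_distinct[OF alternating_kern_left])
  qed (use assms in \<open>auto simp: tuples_def finite_lists_length_eq\<close>)
  also have "\<dots> = (\<Sum>x\<in>tuples j (X - {i}). (1 - ?c) * kern (?c / (1 - ?c)) (map f x) (map g x))"
  proof (intro sum.cong refl)
    fix x assume "x \<in> tuples j (X - {i})"
    hence x: "set x \<subseteq> X" "i \<notin> set x" by (auto simp: tuples_def)
    hence "f i \<notin> set (map f x)" "g i \<notin> set (map g x)"
      using inj_on_image_mem_iff[OF assms(4,3)] inj_on_image_mem_iff[OF assms(5,3)] by simp_all
    hence "f i \<notin> set (map f x)" "f i \<notin> set (map g x)" unfolding assms(6) by simp_all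
    thus "kern ?c (f i # map f x) (g i # map g x) = (1 - ?c) * kern (?c / (1 - ?c)) (map f x) (map g x)"
      unfolding assms(6)[symmetric] by (rule kern_Cons_same[OF c(1)])
  qed
  finally show ?thesis
    unfolding c(2) by (simp add: pair_trace_def sum_distrib_left[symmetric])
qed

text \<open>Transported back to \<open>X\<close> along \<open>f\<close>, the first kernel in
  \<open>lift_kern\<close> reproduces the second one as a form in \<open>x\<close>; the sum over
  \<open>i\<close>, carried to \<open>Y\<close> by \<open>g\<close>, is then a partial
  trace.\<close>

lemma sum_lift_kern:
  fixes f g :: "'a \<Rightarrow> 'b"
  assumes X: "finite X" "card X \<ge> 2" and f: "bij_betw f X Y" and g: "bij_betw g X Y"
  shows "(\<Sum>i\<in>X. \<Sum>x\<in>tuples j X. lift_kern (1 / card X) j Y (f i) (map f x) (g i) (map g x))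
    = (fact j)\<^sup>2 * (1 - 1 / card X) * (real (card X) - 1 - j) * pair_trace j X f g"
proof -
  let ?c = "1 / card X" and ?T = "tuples j X"
  have Y: "finite Y" "card Y = card X" "Y \<noteq> {}"
    using X f bij_betw_finite[OF f] bij_betw_same_card[OF f] by auto
  have im: "f ` X = Y" "g ` X = Y" "inj_on f X" using f g by (auto simp: bij_betw_def)
  have "(\<Sum>i\<in>X. \<Sum>x\<in>?T. lift_kern ?c j Y (f i) (map f x) (g i) (map g x))
      = (\<Sum>i\<in>X. \<Sum>w\<in>?T. \<Sum>x\<in>?T. kern ?c (i # w) (i # x) * kern ?c (map g (i # x)) (g i # map f w))"
    unfolding lift_kern_def sum_tuples_map[OF f]
  proof (rule sum.cong[OF refl], subst sum.swap, intro sum.cong refl)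
    fix i w x assume "i \<in> X" "w \<in> ?T" "x \<in> ?T"
    hence "kern ?c (map f (i # x)) (map f (i # w)) = kern ?c (i # x) (i # w)"
      by (intro kern_map[OF im(3)]) (auto simp: tuples_def)
    thus "kern ?c (f i # map f x) (f i # map f w) * kern ?c (g i # map g x) (g i # map f w)
       = kern ?c (i # w) (i # x) * kern ?c (map g (i # x)) (g i # map f w)"
      by (simp add: kern_sym)
  qed
  also have "\<dots> = (\<Sum>i\<in>X. \<Sum>w\<in>?T. fact j * (1 - ?c) * kern ?c (map g (i # w)) (g i # map f w))"
  proof (intro sum.cong refl)
    fix i w assume iw: "i \<in> X" "w \<in> ?T"
    let ?v = "g i # map f w"
    have v: "set ?v \<subseteq> Y" using iw im by (auto simp: tuples_def)
    show "(\<Sum>x\<in>?T. kern ?c (i # w) (i # x) * kern ?c (map g (i # x)) ?v)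
        = fact j * (1 - ?c) * kern ?c (map g (i # w)) ?v"
    proof (rule kern_reproducing_Cons[OF X refl iw(1) _ _ iw(2)])
      show "alternating (\<lambda>z. kern ?c (map g z) ?v)"
        by (rule alternating_map[OF alternating_kern_left])
      show "zero_sum X (\<lambda>z. kern ?c (map g z) ?v)"
        unfolding zero_sum_def
      proof (intro allI impI)
        fix vs assume "set vs \<subseteq> X"
        hence "set (map g vs) \<subseteq> Y" using im by auto
        moreover have "zero_sum Y (\<lambda>z. kern ?c z ?v)"
          using Y v by (intro zero_sum_kern_left) auto
        ultimately have "(\<Sum>y\<in>Y. kern ?c (y # map g vs) ?v) = 0" by (simp add: zero_sum_def)
        thus "(\<Sum>y\<in>X. kern ?c (map g (y # vs)) ?v) = 0"
          by (simp add: sum.reindex_bij_betw[OF g, of "\<lambda>y. kern ?c (y # map g vs) ?v"])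
      qed
    qed
  qed
  also have "\<dots> = fact j * (1 - ?c) * (\<Sum>w\<in>?T. \<Sum>i\<in>X. kern ?c (g i # map g w) (g i # map f w))"
    by (subst sum.swap) (simp add: sum_distrib_left)
  also have "\<dots> = fact j * (1 - ?c) * (\<Sum>w\<in>?T. (real (card X) - 1 - j) * kern ?c (map f w) (map g w))"
  proof (intro sum.cong refl arg_cong2[of _ _ _ _ "(*)"])
    fix w assume "w \<in> ?T"
    hence "map g w \<in> tuples j Y" "map f w \<in> tuples j Y"
      using im by (auto intro: map_in_tuples)
    hence "(\<Sum>i\<in>Y. kern ?c (i # map g w) (i # map f w)) = (real (card Y) - 1 - j) * kern ?c (map g w) (map f w)"
      using Y by (intro kern_contract) auto
    thus "(\<Sum>i\<in>X. kern ?c (g i # map g w) (g i # map f w)) = (real (card X) - 1 - j) * kern ?c (map f w) (map g w)"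
      using sum.reindex_bij_betw[OF g, of "\<lambda>i. kern ?c (i # map g w) (i # map f w)"]
      by (simp add: Y(2) kern_sym)
  qed
  finally show ?thesis
    by (simp add: pair_trace_def sum_distrib_left[symmetric] power2_eq_square)
qed

text \<open>The residuals of the members of \<open>A\<close>, added up, have a nonnegative squared
  norm over all \<open>i\<close>, \<open>x\<close>, \<open>b\<close>, \<open>z\<close>. By
  \<open>gram_residual\<close> it equals, up to a positive factor, the right side minus
  \<open>energy (Suc j) X A\<close>, which comes from \<open>kern\<close>, minus
  \<open>energy j X A\<close>, which comes from \<open>lift_kern\<close>. The bound on
  \<open>j\<close> keeps the denominator \<open>m\<close> positive.\<close>

lemma energy_branching:
  fixes A :: "('a \<Rightarrow> 'b) set"
  assumes A: "finite A" "\<And>f. f \<in> A \<Longrightarrow> bij_betw f X Y"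
    and X: "finite X" "finite Y" "j + 2 \<le> card X"
  shows "energy j X A + energy (Suc j) X A \<le> (\<Sum>i\<in>X. \<Sum>i'\<in>Y. energy j (X - {i}) (restr A i i'))"
proof (cases "A = {}")
  case True
  thus ?thesis by (simp add: energy_def restr_def)
next
  case False
  then obtain f0 where f0: "bij_betw f0 X Y" using A(2) by blast
  have card: "card Y = card X" using bij_betw_same_card[OF f0] by simp
  define c where "c = 1 / real (card X)"
  define m where "m = real (card X) - 1 - j"
  have X2: "card X \<ge> 2" and m: "m > 0" and c: "1 - c > 0" using X(3) by (auto simp: m_def c_def field_simps)
  let ?TX = "tuples j X" and ?TY = "tuples j Y"
  let ?r = "\<lambda>f i x. residual Y c j (f i) (map f x)"
  have gram: "(\<Sum>i\<in>X. \<Sum>x\<in>?TX. \<Sum>b\<in>Y. \<Sum>z\<in>?TY. ?r f i x b z * ?r g i x b z)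
      = (fact j)\<^sup>2 * (1 - c)\<^sup>2 * (\<Sum>i\<in>X. of_bool (f i = g i) * pair_trace j (X - {i}) f g)
        - (fact j)\<^sup>2 * (1 - c)\<^sup>2 * pair_trace (Suc j) X f g - (fact j)\<^sup>2 * (1 - c)\<^sup>2 * pair_trace j X f g"
    if fg: "f \<in> A" "g \<in> A" for f g
  proof -
    have bij: "bij_betw f X Y" "bij_betw g X Y" and im: "f ` X = Y" "g ` X = Y" "inj_on f X" "inj_on g X"
      using A(2) fg by (auto simp: bij_betw_def)
    have "(\<Sum>i\<in>X. \<Sum>x\<in>?TX. \<Sum>b\<in>Y. \<Sum>z\<in>?TY. ?r f i x b z * ?r g i x b z)
        = (\<Sum>i\<in>X. \<Sum>x\<in>?TX. fact j * (1 - c) * of_bool (f i = g i) * kern c (f i # map f x) (g i # map g x)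
            - fact j * (1 - c)\<^sup>2 / Suc j * kern c (f i # map f x) (g i # map g x)
            - (1 - c) / m * lift_kern c j Y (f i) (map f x) (g i) (map g x))"
    proof (intro sum.cong refl)
      fix i x assume "i \<in> X" "x \<in> ?TX"
      thus "(\<Sum>b\<in>Y. \<Sum>z\<in>?TY. ?r f i x b z * ?r g i x b z)
        = fact j * (1 - c) * of_bool (f i = g i) * kern c (f i # map f x) (g i # map g x)
            - fact j * (1 - c)\<^sup>2 / Suc j * kern c (f i # map f x) (g i # map g x)
            - (1 - c) / m * lift_kern c j Y (f i) (map f x) (g i) (map g x)"
        unfolding m_def using im X X2 m
        by (subst gram_residual) (auto simp: card c_def m_def intro: map_in_tuples)
    qed
    also have "\<dots> = fact j * (1 - c) * (\<Sum>i\<in>X. of_bool (f i = g i) * (\<Sum>x\<in>?TX. kern c (f i # map f x) (g i # map g x)))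
        - fact j * (1 - c)\<^sup>2 / Suc j * (\<Sum>x\<in>tuples (Suc j) X. kern c (map f x) (map g x))
        - (1 - c) / m * (\<Sum>i\<in>X. \<Sum>x\<in>?TX. lift_kern c j Y (f i) (map f x) (g i) (map g x))"
      unfolding sum_tuples_Suc[of _ j X] sum.swap[of _ X ?TX]
      by (simp add: sum_subtractf sum_distrib_left mult_ac)
    also have "(\<Sum>i\<in>X. of_bool (f i = g i) * (\<Sum>x\<in>?TX. kern c (f i # map f x) (g i # map g x)))
        = (\<Sum>i\<in>X. of_bool (f i = g i) * ((1 - c) * fact j * pair_trace j (X - {i}) f g))"
    proof (rule sum.cong[OF refl])
      fix i assume "i \<in> X"
      thus "of_bool (f i = g i) * (\<Sum>x\<in>?TX. kern c (f i # map f x) (g i # map g x))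
         = of_bool (f i = g i) * ((1 - c) * fact j * pair_trace j (X - {i}) f g)"
        using pair_trace_restr[OF X(1) X2 _ im(3,4), of i j] by (simp add: c_def)
    qed
    also have "(\<Sum>x\<in>tuples (Suc j) X. kern c (map f x) (map g x)) = fact (Suc j) * pair_trace (Suc j) X f g"
      by (simp add: pair_trace_def c_def)
    also have "(\<Sum>i\<in>X. \<Sum>x\<in>?TX. lift_kern c j Y (f i) (map f x) (g i) (map g x))
        = (fact j)\<^sup>2 * (1 - c) * m * pair_trace j X f g"
      using sum_lift_kern[OF X(1) X2 bij] by (simp add: c_def m_def)
    also have "fact j * (1 - c)\<^sup>2 / Suc j * (fact (Suc j) * pair_trace (Suc j) X f g)
        = (fact j)\<^sup>2 * (1 - c)\<^sup>2 * pair_trace (Suc j) X f g"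
      by (simp add: power2_eq_square field_simps del: of_nat_Suc)
    also have "(1 - c) / m * ((fact j)\<^sup>2 * (1 - c) * m * pair_trace j X f g) = (fact j)\<^sup>2 * (1 - c)\<^sup>2 * pair_trace j X f g"
      using m by (simp add: power2_eq_square)
    finally show ?thesis by (simp add: sum_distrib_left power2_eq_square mult_ac)
  qed
  have fY: "f i \<in> Y" if "f \<in> A" "i \<in> X" for f i using A(2)[OF that(1)] that(2) by (auto simp: bij_betw_def)
  let ?R = "\<Sum>i\<in>X. \<Sum>i'\<in>Y. energy j (X - {i}) (restr A i i')"
  have R: "?R = (\<Sum>f\<in>A. \<Sum>g\<in>A. \<Sum>i\<in>X. of_bool (f i = g i) * pair_trace j (X - {i}) f g)"
  proof -
    have "?R = (\<Sum>i\<in>X. \<Sum>f\<in>A. \<Sum>g\<in>A. of_bool (f i = g i) * pair_trace j (X - {i}) f g)"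
      unfolding energy_def using fY by (intro sum.cong refl sum_restr A X) auto
    thus ?thesis by (simp only: sum.swap[of _ A X])
  qed
  have "0 \<le> (\<Sum>i\<in>X. \<Sum>x\<in>?TX. \<Sum>b\<in>Y. \<Sum>z\<in>?TY. (\<Sum>f\<in>A. ?r f i x b z)\<^sup>2)"
    by (intro sum_nonneg) simp
  also have "\<dots> = (\<Sum>f\<in>A. \<Sum>g\<in>A. \<Sum>i\<in>X. \<Sum>x\<in>?TX. \<Sum>b\<in>Y. \<Sum>z\<in>?TY. ?r f i x b z * ?r g i x b z)"
    unfolding power2_eq_square sum_product_swap
    by (simp only: sum.swap[of _ A Y] sum.swap[of _ A ?TX] sum.swap[of _ A X])
  also have "\<dots> = (\<Sum>f\<in>A. \<Sum>g\<in>A. (fact j)\<^sup>2 * (1 - c)\<^sup>2 * (\<Sum>i\<in>X. of_bool (f i = g i) * pair_trace j (X - {i}) f g)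
        - (fact j)\<^sup>2 * (1 - c)\<^sup>2 * pair_trace (Suc j) X f g - (fact j)\<^sup>2 * (1 - c)\<^sup>2 * pair_trace j X f g)"
    by (intro sum.cong refl gram)
  also have "\<dots> = (fact j)\<^sup>2 * (1 - c)\<^sup>2 * (?R - energy (Suc j) X A - energy j X A)"
    unfolding R unfolding energy_def sum_subtractf sum_distrib_left[symmetric] right_diff_distrib by (rule refl)
  finally have "0 \<le> (fact j)\<^sup>2 * (1 - c)\<^sup>2 * (?R - energy (Suc j) X A - energy j X A)" .
  moreover have "(fact j)\<^sup>2 * (1 - c)\<^sup>2 > 0" using c by simp
  ultimately show ?thesis by (simp only: zero_le_mult_iff) linarith
qed

section \<open>Alternating sums and extreme degrees\<close>

lemma minor_border:
  assumes "length x = j"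
  shows "minor M (y # x) (n # x') = M y n * minor M x x'
    + (\<Sum>b<j. (-1) ^ Suc b * M (x ! b) n * minor M (y # take b x @ drop (Suc b) x) x')"
proof (cases "length x' = j")
  case True
  have "minor M (y # x) (n # x') = minor (\<lambda>b a. M a b) (n # x') (y # x)"
    by (rule minor_transpose)
  also have "\<dots> = (\<Sum>b<Suc j. (-1) ^ b * M ((y # x) ! b) n
      * minor (\<lambda>b a. M a b) x' (take b (y # x) @ drop (Suc b) (y # x)))"
    using True assms by (subst minor_Cons) simp_all
  also have "\<dots> = (\<Sum>b<Suc j. (-1) ^ b * M ((y # x) ! b) n
      * minor M (take b (y # x) @ drop (Suc b) (y # x)) x')"
    by (simp only: minor_transpose[of M _ x'])
  finally show ?thesis by (simp add: sum.lessThan_Suc_shift del: sum.lessThan_Suc)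
qed (use assms in \<open>simp add: minor_def\<close>)

text \<open>The sum is \<open>det (1 - M)\<close> written through principal minors:
  \<open>fact j\<close> accounts for the orderings of an index set, and tuples with a repetition
  vanish. The fixed vector \<open>v\<close> makes \<open>1 - M\<close> singular.\<close>

lemma alternating_sum_principal_minors:
  fixes M :: "'a \<Rightarrow> 'a \<Rightarrow> real"
  assumes "finite X" and v: "\<And>r. r \<in> X \<Longrightarrow> (\<Sum>t\<in>X. M r t * v t) = v r" and nz: "y0 \<in> X" "v y0 \<noteq> 0"
  shows "(\<Sum>j\<le>card X. (-1) ^ j * ((\<Sum>x\<in>tuples j X. minor M x x) / fact j)) = 0"
proof -
  define N where "N = (\<lambda>r. case_option (v r) (M r))"
  have N [simp]: "N r None = v r" "N r (Some t) = M r t" for r t by (simp_all add: N_def)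
  \<comment> \<open>Bordering the principal minors by \<open>v\<close> makes the sum telescope: \<open>D (Suc j) + D j\<close> is \<open>v y0\<close>
    times the \<open>(j + 1)\<close>-st term, and \<open>D (card X) = 0\<close> because a row is repeated.\<close>
  define D where "D j = (\<Sum>x\<in>tuples j X. minor N (y0 # x) (None # map Some x)) / fact j" for j
  let ?e = "\<lambda>j. (\<Sum>x\<in>tuples j X. minor M x x) / fact j"
  have NM: "minor N x (map Some x') = minor M x x'" for x x'
    using minor_map[of N id x Some x'] by simp
  have rec: "D (Suc j) = v y0 * ?e (Suc j) - D j" for j
  proof -
    \<comment> \<open>Summing the entry at position \<open>b\<close> against \<open>v\<close>
      replaces the column it indexes by \<open>M v = v\<close>, which is the border column
      \<open>None\<close>; so every position contributes the same.\<close>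
    have pos: "(\<Sum>x\<in>tuples (Suc j) X. (-1) ^ Suc b * N (x ! b) None
        * minor N (y0 # take b x @ drop (Suc b) x) (map Some x)) = - fact j * D j" if b: "b < Suc j" for b
    proof -
      have "(\<Sum>x\<in>tuples (Suc j) X. (-1) ^ Suc b * N (x ! b) None * minor N (y0 # take b x @ drop (Suc b) x) (map Some x))
          = (\<Sum>z\<in>tuples j X. - (\<Sum>t\<in>X. v t * minor N (y0 # z) (Some t # map Some z)))"
        unfolding sum_negf[symmetric] sum_tuples_insert[OF b[unfolded less_Suc_eq_le]]
      proof (intro sum.cong refl)
        fix z t assume z: "z \<in> tuples j X"
        let ?x = "take b z @ t # drop b z"
        have len: "length z = j" "b \<le> j" using z b by (auto simp: tuples_def)
        have "minor N (y0 # z) (map Some ?x) = (-1) ^ b * minor N (y0 # z) (Some t # map Some z)"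
          using alternating_move[OF alternating_minor_right, of N "y0 # z" "map Some (take b z)" "Some t" "map Some (drop b z)"]
            len by (simp flip: map_append) simp
        moreover have "?x ! b = t" "take b ?x @ drop (Suc b) ?x = z"
          using len by (simp_all add: nth_append min_def)
        ultimately show "(-1) ^ Suc b * N (?x ! b) None * minor N (y0 # take b ?x @ drop (Suc b) ?x) (map Some ?x)
            = - (v t * minor N (y0 # z) (Some t # map Some z))"
          by (simp add: power_mult_distrib[symmetric])
      qed
      also have "\<dots> = (\<Sum>z\<in>tuples j X. - minor N (y0 # z) (None # map Some z))"
        by (intro sum.cong refl arg_cong[of _ _ uminus] minor_column_sum)
          (use v nz in \<open>auto simp: tuples_def mult.commute\<close>)
      finally show ?thesis by (simp add: D_def sum_negf)
    qed
    have "fact (Suc j) * D (Suc j) = (\<Sum>x\<in>tuples (Suc j) X. v y0 * minor M x x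
        + (\<Sum>b<Suc j. (-1) ^ Suc b * N (x ! b) None * minor N (y0 # take b x @ drop (Suc b) x) (map Some x)))"
      unfolding D_def
      by (simp del: fact_Suc power_Suc sum.lessThan_Suc, intro sum.cong refl, subst minor_border[of _ "Suc j"])
        (simp_all add: tuples_def NM del: power_Suc sum.lessThan_Suc)
    also have "\<dots> = v y0 * (\<Sum>x\<in>tuples (Suc j) X. minor M x x) - fact (Suc j) * D j"
    proof -
      have "(\<Sum>x\<in>tuples (Suc j) X. \<Sum>b<Suc j. (-1) ^ Suc b * N (x ! b) None
          * minor N (y0 # take b x @ drop (Suc b) x) (map Some x)) = (\<Sum>b<Suc j. - fact j * D j)"
        by (subst sum.swap, intro sum.cong refl pos) simp
      thus ?thesis
        unfolding sum.distrib sum_distrib_left[symmetric] by (simp only:) (simp add: algebra_simps)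
    qed
    finally have "fact (Suc j) * D (Suc j) = fact (Suc j) * (v y0 * ?e (Suc j) - D j)"
      by (simp add: right_diff_distrib del: fact_Suc)
    thus ?thesis by (simp del: fact_Suc)
  qed
  have partial: "v y0 * (\<Sum>j\<le>k. (-1) ^ j * ?e j) = (-1) ^ k * D k" for k
  proof (induction k)
    case 0
    show ?case by (simp add: D_def minor_border)
  next
    case (Suc k)
    have "v y0 * (\<Sum>j\<le>Suc k. (-1) ^ j * ?e j) = (-1) ^ k * D k + (-1) ^ Suc k * (v y0 * ?e (Suc k))"
      unfolding Suc[symmetric] by (simp add: algebra_simps del: fact_Suc)
    thus ?case unfolding rec by (simp add: algebra_simps del: fact_Suc)
  qed
  have "D (card X) = 0"
  proof -
    have "minor N (y0 # x) (None # map Some x) = 0" if "x \<in> tuples (card X) X" for x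
    proof -
      have "\<not> distinct (y0 # x)"
      proof
        assume "distinct (y0 # x)"
        moreover have "set (y0 # x) \<subseteq> X" using that nz by (auto simp: tuples_def)
        ultimately have "length (y0 # x) \<le> card X"
          using card_mono[OF assms(1), of "set (y0 # x)"] distinct_card[of "y0 # x"] by simp
        thus False using that by (simp add: tuples_def)
      qed
      thus ?thesis using alternating_not_distinct[OF alternating_minor_left] by fast
    qed
    thus ?thesis by (simp add: D_def)
  qed
  hence "v y0 * (\<Sum>j\<le>card X. (-1) ^ j * ?e j) = 0" unfolding partial by simp
  thus ?thesis using nz by simp
qed

text \<open>The standard representation has dimension only \<open>card S - 1\<close>. Concretely, a
  tuple without repetition exhausts \<open>S\<close>, and in the vanishing sum over its first entry
  every other term has a repetition.\<close>

lemma form_top_degree_zero: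
  assumes "finite S" "alternating h" "zero_sum S h" "x \<in> tuples (card S) S" "S \<noteq> {}"
  shows "h x = 0"
proof (cases "distinct x")
  case True
  obtain y vs where x: "x = y # vs" using assms by (cases x) (auto simp: tuples_def)
  have sub: "set x \<subseteq> S" "length x = card S" using assms(4) by (auto simp: tuples_def)
  hence "set x = S" using card_subset_eq[OF assms(1)] distinct_card[OF True] by simp
  hence S: "S = insert y (set vs)" "y \<notin> set vs" using x True by auto
  have "(\<Sum>z\<in>S. h (z # vs)) = h (y # vs) + (\<Sum>z\<in>set vs. h (z # vs))"
    using S by simp
  also have "(\<Sum>z\<in>set vs. h (z # vs)) = 0"
    by (intro sum.neutral ballI alternating_not_distinct[OF assms(2)]) simp
  also have "(\<Sum>z\<in>S. h (z # vs)) = 0"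
    using assms(3) sub x by (simp add: zero_sum_def)
  finally show ?thesis using x by simp
qed (rule alternating_not_distinct[OF assms(2)])

lemma pair_trace_alternating_sum:
  assumes X: "finite X" and f: "bij_betw f X Y" and g: "bij_betw g X Y"
    and U: "U \<subset> X" "U \<noteq> {}" "f ` U = g ` U"
  shows "(\<Sum>j<card X. (-1) ^ j * pair_trace j X f g) = 0"
proof -
  define c where "c = 1 / real (card X)"
  define M where "M = (\<lambda>a b. of_bool (f a = g b) - c)"
  \<comment> \<open>Being constant on \<open>U\<close> and on \<open>X - U\<close>, this vector is
    fixed by \<open>g\<^sup>-\<^sup>1 \<circ> f\<close>, which preserves \<open>U\<close>; the
    weights make its total zero, so that the part of \<open>M\<close> with \<open>c\<close> kills
    it.\<close>
  define v where "v a = (if a \<in> U then real (card (X - U)) else - real (card U))" for a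
  have pt: "pair_trace j X f g = (\<Sum>x\<in>tuples j X. minor M x x) / fact j" for j
    by (simp add: pair_trace_def kern_def minor_map M_def c_def)
  have fin: "finite U" "finite (X - U)" "X - U \<noteq> {}" using U X finite_subset by auto
  have "(\<Sum>a\<in>X. v a) = (\<Sum>a\<in>U. v a) + (\<Sum>a\<in>X - U. v a)"
    using U(1) X by (metis add.commute psubset_imp_subset sum.subset_diff)
  hence v0: "(\<Sum>a\<in>X. v a) = 0" by (simp add: v_def)
  have vM: "(\<Sum>t\<in>X. M r t * v t) = v r" if r: "r \<in> X" for r
  proof -
    obtain t where t: "t \<in> X" "f r = g t" using f g r by (auto simp: bij_betw_def)
    have "t \<in> U \<longleftrightarrow> r \<in> U"
    proof
      assume "t \<in> U"
      hence "g t \<in> g ` U" by blast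
      hence "f r \<in> f ` U" using t(2) U(3) by simp
      thus "r \<in> U" using f r U by (auto simp: bij_betw_def inj_on_def)
    next
      assume "r \<in> U"
      hence "f r \<in> f ` U" by blast
      hence "g t \<in> g ` U" using t(2) U(3) by simp
      thus "t \<in> U" using g t U by (auto simp: bij_betw_def inj_on_def)
    qed
    hence vt: "v t = v r" by (simp add: v_def)
    have "(\<Sum>s\<in>X. M r s * v s) = (\<Sum>s\<in>X. of_bool (f r = g s) * v s) - c * (\<Sum>s\<in>X. v s)"
      by (simp add: M_def left_diff_distrib sum_subtractf sum_distrib_left)
    also have "(\<Sum>s\<in>X. of_bool (f r = g s) * v s) = (\<Sum>s\<in>X. of_bool (s = t) * v s)"
      using t g by (intro sum.cong refl) (auto simp: bij_betw_def inj_on_def)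
    finally show ?thesis using t X vt v0 by simp
  qed
  obtain y0 where "y0 \<in> U" using U by auto
  hence "y0 \<in> X" "v y0 \<noteq> 0" using U fin by (auto simp: v_def)
  from alternating_sum_principal_minors[OF X vM this]
  have "(\<Sum>j\<le>card X. (-1) ^ j * pair_trace j X f g) = 0" by (simp add: pt)
  \<comment> \<open>The expansion of the determinant runs up to degree \<open>card X\<close>, one
    more than the claim; the power in that degree is zero.\<close>
  moreover have "pair_trace (card X) X f g = 0"
  proof -
    have Y: "finite Y" "card X = card Y" "Y \<noteq> {}"
      using X f bij_betw_finite[OF f] bij_betw_same_card[OF f] \<open>y0 \<in> X\<close> by (auto simp: bij_betw_def)
    have "kern (1 / card X) (map f x) (map g x) = 0" if "x \<in> tuples (card X) X" for x
    proof -
      have "map f x \<in> tuples (card X) Y" "map g x \<in> tuples (card X) Y"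
        using that f g by (auto simp: bij_betw_def intro!: map_in_tuples)
      thus ?thesis unfolding Y(2) using Y
        by (intro form_top_degree_zero[of Y "kern _ _"] alternating_kern_right zero_sum_kern_right)
          (auto simp: tuples_def)
    qed
    thus ?thesis by (simp add: pair_trace_def)
  qed
  ultimately show ?thesis by (simp add: lessThan_Suc_atMost[symmetric])
qed

text \<open>The dimension of the exterior power: a partial trace lowers the degree by one and,
  divided by \<open>Suc j\<close>, supplies the ratio of consecutive binomial coefficients.\<close>

lemma pair_trace_refl:
  assumes X: "finite X" "X \<noteq> {}" and f: "inj_on f X"
  shows "pair_trace j X f f = real ((card X - 1) choose j)"
proof (induction j)
  case (Suc j)
  let ?k = "kern (1 / card X)" and ?N = "card X - 1"
  have N: "real ?N = real (card X) - 1" using X by (simp add: of_nat_diff Suc_le_eq card_gt_0_iff)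
  have eq: "pair_trace i X f f = (\<Sum>x\<in>tuples i X. ?k x x) / fact i" for i
    unfolding pair_trace_def
    by (intro arg_cong2[of _ _ _ _ "(/)"] sum.cong refl kern_map[OF f]) (auto simp: tuples_def)
  have "(\<Sum>x\<in>tuples (Suc j) X. ?k x x) = (real (card X) - 1 - j) * (\<Sum>x\<in>tuples j X. ?k x x)"
    unfolding sum_tuples_Suc sum_distrib_left using kern_contract[OF X refl] by simp
  hence "pair_trace (Suc j) X f f = (real ?N - j) / Suc j * pair_trace j X f f"
    unfolding eq N by (simp add: field_simps)
  also have "\<dots> = real (?N choose Suc j)"
  proof (cases "j \<le> ?N")
    case True
    have "Suc j * (?N choose Suc j) = (?N - j) * (?N choose j)"
      using binomial_absorb_comp[of ?N j] Suc_times_binomial_add[of j] True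
      by (metis binomial_absorption binomial_absorb_comp mult.commute)
    hence "real (Suc j) * real (?N choose Suc j) = (real ?N - j) * real (?N choose j)"
      using True by (metis of_nat_diff of_nat_mult)
    thus ?thesis unfolding Suc by (simp add: field_simps del: of_nat_Suc)
  qed (use Suc in \<open>simp add: binomial_eq_0\<close>)
  finally show ?case .
qed simp

text \<open>Both kernels have norm \<open>fact (card X - 1)\<close> because the power is
  one-dimensional; the bound is Cauchy--Schwarz for \<open>pair_trace_gram\<close>, in the form of
  the arithmetic-geometric mean inequality.\<close>

lemma pair_trace_top_le:
  assumes X: "finite X" "X \<noteq> {}" and f: "bij_betw f X Y" and g: "bij_betw g X Y"
  shows "pair_trace (card X - 1) X f g \<le> 1"
proof -
  let ?N = "card X - 1"
  let ?k = "\<lambda>f x z. kern (1 / card Y) (map f x) z"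
  have Y: "finite Y" "Y \<noteq> {}" using X f bij_betw_finite[OF f] by (auto simp: bij_betw_def)
  have one: "(\<Sum>x\<in>tuples ?N X. \<Sum>z\<in>tuples ?N Y. (?k h x z)\<^sup>2) = (fact ?N)\<^sup>2" if "bij_betw h X Y" for h
    using pair_trace_gram[OF Y that that, of ?N] pair_trace_refl[OF X bij_betw_imp_inj_on[OF that], of ?N]
    by (simp add: power2_eq_square)
  have "(fact ?N)\<^sup>2 * pair_trace ?N X f g = (\<Sum>x\<in>tuples ?N X. \<Sum>z\<in>tuples ?N Y. ?k f x z * ?k g x z)"
    by (rule pair_trace_gram[OF Y f g])
  also have "\<dots> \<le> (\<Sum>x\<in>tuples ?N X. \<Sum>z\<in>tuples ?N Y. ((?k f x z)\<^sup>2 + (?k g x z)\<^sup>2) / 2)"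
  proof (intro sum_mono)
    fix x z
    show "?k f x z * ?k g x z \<le> ((?k f x z)\<^sup>2 + (?k g x z)\<^sup>2) / 2"
      using sum_squares_bound[of "?k f x z" "?k g x z"] by simp
  qed
  also have "\<dots> = (fact ?N)\<^sup>2"
    unfolding sum_divide_distrib[symmetric] sum.distrib one[OF f] one[OF g] by simp
  finally show ?thesis by simp
qed

section \<open>Families without single-cycle quotients\<close>

text \<open>The \<open>k\<close> pairs \<open>(i, i')\<close> are prescribed in order, so a set of
  pairs counts once for each of its orderings, as repeated use of \<open>energy_branching\<close>
  requires.\<close>

fun iter_restr :: "nat \<Rightarrow> ('a set \<Rightarrow> 'b set \<Rightarrow> ('a \<Rightarrow> 'b) set \<Rightarrow> real)
    \<Rightarrow> 'a set \<Rightarrow> 'b set \<Rightarrow> ('a \<Rightarrow> 'b) set \<Rightarrow> real" where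
  "iter_restr 0 \<Phi> X Y A = \<Phi> X Y A"
| "iter_restr (Suc k) \<Phi> X Y A = (\<Sum>i\<in>X. \<Sum>i'\<in>Y. iter_restr k \<Phi> (X - {i}) (Y - {i'}) (restr A i i'))"

text \<open>The condition on \<open>U\<close> expresses that \<open>g\<^sup>-\<^sup>1 \<circ> f\<close> is not a single cycle on any \<open>Z\<close> outside of
  which \<open>f\<close> and \<open>g\<close> agree; the condition on \<open>kern\<close> says that \<open>g\<^sup>-\<^sup>1 \<circ> f\<close> is even.\<close>

definition cycle_free_family :: "'a set \<Rightarrow> 'b set \<Rightarrow> ('a \<Rightarrow> 'b) set \<Rightarrow> bool" where
  "cycle_free_family X Y A \<longleftrightarrow> finite X \<and> finite Y \<and> card X = card Y \<and> finite A
    \<and> (\<forall>f\<in>A. bij_betw f X Y)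
    \<and> (\<forall>f\<in>A. \<forall>g\<in>A. (\<forall>x\<in>X. f x = g x) \<longrightarrow> f = g)
    \<and> (\<forall>f\<in>A. \<forall>g\<in>A. \<forall>Z\<subseteq>X. card Z \<ge> 2 \<longrightarrow> (\<forall>x\<in>X - Z. f x = g x)
        \<longrightarrow> (\<exists>U\<subset>Z. U \<noteq> {} \<and> f ` U = g ` U))
    \<and> (\<forall>f\<in>A. \<forall>g\<in>A. \<forall>x\<in>tuples (card X - 1) X. \<forall>y\<in>tuples (card X - 1) Y.
        kern (1 / card X) (map f x) y = kern (1 / card X) (map g x) y)"

lemma cycle_free_familyD:
  assumes "cycle_free_family X Y A"
  shows "finite X" "finite Y" "card X = card Y" "finite A" "f \<in> A \<Longrightarrow> bij_betw f X Y"
    and "f \<in> A \<Longrightarrow> g \<in> A \<Longrightarrow> (\<And>x. x \<in> X \<Longrightarrow> f x = g x) \<Longrightarrow> f = g"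
    and "f \<in> A \<Longrightarrow> g \<in> A \<Longrightarrow> Z \<subseteq> X \<Longrightarrow> card Z \<ge> 2 \<Longrightarrow> (\<And>x. x \<in> X - Z \<Longrightarrow> f x = g x)
      \<Longrightarrow> \<exists>U\<subset>Z. U \<noteq> {} \<and> f ` U = g ` U"
    and "f \<in> A \<Longrightarrow> g \<in> A \<Longrightarrow> x \<in> tuples (card X - 1) X \<Longrightarrow> y \<in> tuples (card X - 1) Y
      \<Longrightarrow> kern (1 / card X) (map f x) y = kern (1 / card X) (map g x) y"
proof -
  note c2 = conjunct2 and A = assms[unfolded cycle_free_family_def]
  note B = A[THEN c2, THEN c2, THEN c2, THEN c2]
  show "finite X" "finite Y" "card X = card Y" "finite A"
    by (fact A[THEN conjunct1] A[THEN c2, THEN conjunct1] A[THEN c2, THEN c2, THEN conjunct1]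
      A[THEN c2, THEN c2, THEN c2, THEN conjunct1])+
  show "f \<in> A \<Longrightarrow> bij_betw f X Y" by (fact B[THEN conjunct1, rule_format])
  show "f \<in> A \<Longrightarrow> g \<in> A \<Longrightarrow> (\<And>x. x \<in> X \<Longrightarrow> f x = g x) \<Longrightarrow> f = g"
    by (fact B[THEN c2, THEN conjunct1, rule_format])
  show "f \<in> A \<Longrightarrow> g \<in> A \<Longrightarrow> Z \<subseteq> X \<Longrightarrow> card Z \<ge> 2 \<Longrightarrow> (\<And>x. x \<in> X - Z \<Longrightarrow> f x = g x)
      \<Longrightarrow> \<exists>U\<subset>Z. U \<noteq> {} \<and> f ` U = g ` U"
    by (fact B[THEN c2, THEN c2, THEN conjunct1, rule_format])
  show "f \<in> A \<Longrightarrow> g \<in> A \<Longrightarrow> x \<in> tuples (card X - 1) X \<Longrightarrow> y \<in> tuples (card X - 1) Y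
      \<Longrightarrow> kern (1 / card X) (map f x) y = kern (1 / card X) (map g x) y"
    by (fact B[THEN c2, THEN c2, THEN c2, rule_format])
qed

text \<open>Members of the restricted family agree at \<open>i\<close>, so a set \<open>Z\<close>
  for it also serves for \<open>A\<close>. The parity condition descends because the Schur
  complement strips the common entries \<open>i\<close> and \<open>i'\<close> with the same nonzero
  factor for \<open>f\<close> and \<open>g\<close>.\<close>

lemma cycle_free_family_restr:
  assumes A: "cycle_free_family X Y A" and i: "i \<in> X" "i' \<in> Y" and "card X \<ge> 2"
  shows "cycle_free_family (X - {i}) (Y - {i'}) (restr A i i')"
  unfolding cycle_free_family_def
proof (intro conjI ballI allI impI)
  note fin = cycle_free_familyD(1-4)[OF A] and bij = cycle_free_familyD(5)[OF A]
  show "finite (X - {i})" "finite (Y - {i'})" "finite (restr A i i')" "card (X - {i}) = card (Y - {i'})"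
    using fin i by (simp_all add: restr_def)
  show "bij_betw f (X - {i}) (Y - {i'})" if "f \<in> restr A i i'" for f
    using that i bij by (intro bij_betw_DiffI) (auto simp: restr_def bij_betw_def)
  fix f g assume "f \<in> restr A i i'" "g \<in> restr A i i'"
  hence fg: "f \<in> A" "g \<in> A" "f i = i'" "g i = i'" by (auto simp: restr_def)
  show "f = g" if "\<forall>x\<in>X - {i}. f x = g x"
  proof -
    have "f x = g x" if "x \<in> X" for x using that \<open>\<forall>x\<in>X - {i}. f x = g x\<close> fg by (cases "x = i") auto
    thus ?thesis by (rule cycle_free_familyD(6)[OF A fg(1,2)])
  qed
  show "\<exists>U\<subset>Z. U \<noteq> {} \<and> f ` U = g ` U"
    if "Z \<subseteq> X - {i}" "2 \<le> card Z" "\<forall>x\<in>X - {i} - Z. f x = g x" for Z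
  proof -
    have agree: "f x = g x" if "x \<in> X - Z" for x
      using that \<open>\<forall>x\<in>X - {i} - Z. f x = g x\<close> fg by (cases "x = i") auto
    show ?thesis
      by (rule cycle_free_familyD(7)[OF A fg(1,2) _ that(2) agree]) (use that(1) in auto)
  qed
  fix x y assume x: "x \<in> tuples (card (X - {i}) - 1) (X - {i})" and y: "y \<in> tuples (card (X - {i}) - 1) (Y - {i'})"
  let ?c = "1 / card X"
  have card: "card (X - {i}) = card X - 1" using i fin by simp
  have c: "?c \<noteq> 1" "?c / (1 - ?c) = 1 / card (X - {i})"
    using assms(4) i fin(1) by (auto simp: of_nat_diff field_simps)
  have xy: "i # x \<in> tuples (card X - 1) X" "i' # y \<in> tuples (card X - 1) Y"
    using x y i assms(4) fin by (auto simp: tuples_def card)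
  have "set x \<subseteq> X" "i \<notin> set x" "i' \<notin> set y" using x y by (auto simp: tuples_def)
  hence nin: "i' \<notin> set (map h x)" if "h \<in> A" "h i = i'" for h
    using inj_on_image_mem_iff[OF bij_betw_imp_inj_on[OF bij[OF that(1)]] i(1), of "set x"] that(2) by simp
  have "kern ?c (map f (i # x)) (i' # y) = kern ?c (map g (i # x)) (i' # y)"
    by (rule cycle_free_familyD(8)[OF A fg(1,2) xy])
  hence "(1 - ?c) * kern (?c / (1 - ?c)) (map f x) y = (1 - ?c) * kern (?c / (1 - ?c)) (map g x) y"
    using nin fg \<open>i' \<notin> set y\<close> by (simp add: kern_Cons_same[OF c(1)])
  thus "kern (1 / card (X - {i})) (map f x) y = kern (1 / card (X - {i})) (map g x) y"
    using mult_left_cancel[of "1 - ?c"] c(1) unfolding c(2) by (metis right_minus_eq)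
qed

lemma iter_restr_mono:
  assumes "cycle_free_family X Y A" "k < card X"
    and "\<And>X' Y' A'. cycle_free_family X' Y' A' \<Longrightarrow> card X' = card X - k \<Longrightarrow> \<Phi> X' Y' A' \<le> \<Psi> X' Y' A'"
  shows "iter_restr k \<Phi> X Y A \<le> iter_restr k \<Psi> X Y A"
  using assms
proof (induction k arbitrary: X Y A)
  case (Suc k)
  have "iter_restr k \<Phi> (X - {i}) (Y - {i'}) (restr A i i') \<le> iter_restr k \<Psi> (X - {i}) (Y - {i'}) (restr A i i')"
    if "i \<in> X" "i' \<in> Y" for i i'
  proof (rule Suc.IH)
    have "finite X" using cycle_free_familyD(1)[OF Suc.prems(1)] .
    hence card: "card (X - {i}) = card X - 1" using that by simp
    show "cycle_free_family (X - {i}) (Y - {i'}) (restr A i i')"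
      using cycle_free_family_restr[OF Suc.prems(1) that] Suc.prems(2) by simp
    show "k < card (X - {i})" using Suc.prems(2) card by simp
    show "\<Phi> X' Y' A' \<le> \<Psi> X' Y' A'" if "cycle_free_family X' Y' A'" "card X' = card (X - {i}) - k" for X' Y' A'
      using Suc.prems(3) that card by simp
  qed
  thus ?case by (simp add: sum_mono)
qed simp

lemma iter_restr_scale: "iter_restr k (\<lambda>X Y A. t * \<Phi> X Y A) X Y A = t * iter_restr k \<Phi> X Y A"
  by (induction k arbitrary: X Y A) (simp_all add: sum_distrib_left)

text \<open>For each \<open>i\<close> the families \<open>restr A i i'\<close> partition
  \<open>A\<close>, so prescribing one more value multiplies the total size by the number of points
  available.\<close>

lemma iter_restr_card:
  assumes "cycle_free_family X Y A" "k < card X"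
  shows "fact (card X - k) * iter_restr k (\<lambda>_ _ A. card A) X Y A = fact (card X) * real (card A)"
  using assms
proof (induction k arbitrary: X Y A)
  case (Suc k)
  note fin = cycle_free_familyD(1,2,4)[OF Suc.prems(1)] and bij = cycle_free_familyD(5)[OF Suc.prems(1)]
  have step: "fact (card X - Suc k) * iter_restr k (\<lambda>_ _ A. card A) (X - {i}) (Y - {i'}) (restr A i i')
      = fact (card X - 1) * real (card (restr A i i'))" if "i \<in> X" "i' \<in> Y" for i i'
    using Suc.IH[OF cycle_free_family_restr[OF Suc.prems(1) that]] Suc.prems(2) fin that by simp
  have "(\<Sum>i'\<in>Y. card (restr A i i')) = card A" if "i \<in> X" for i
  proof -
    have "A = (\<Union>i'\<in>Y. restr A i i')" using bij that by (fastforce simp: restr_def bij_betw_def)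
    moreover have "card (\<Union>i'\<in>Y. restr A i i') = (\<Sum>i'\<in>Y. card (restr A i i'))"
      using fin by (intro card_UN_disjoint) (auto simp: restr_def)
    ultimately show ?thesis by simp
  qed
  hence "(\<Sum>i'\<in>Y. real (card (restr A i i'))) = card A" if "i \<in> X" for i
    using that by (metis of_nat_sum)
  hence "fact (card X - Suc k) * iter_restr (Suc k) (\<lambda>_ _ A. card A) X Y A
      = (\<Sum>i\<in>X. fact (card X - 1) * real (card A))"
    unfolding iter_restr.simps sum_distrib_left by (simp add: step sum_distrib_left[symmetric])
  thus ?case using Suc.prems(2) by (simp add: fact_reduce[of "card X"])
qed simp

text \<open>Each branching step splits a degree into itself and the next one, and Pascal's rule
  collects the binomial coefficients. The bound on \<open>j + k\<close> keeps every step within the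
  range of \<open>energy_branching\<close>.\<close>

lemma iter_restr_energy:
  assumes "cycle_free_family X Y A" "j + k < card X"
  shows "(\<Sum>i\<le>k. real (k choose i) * energy (j + i) X A) \<le> iter_restr k (\<lambda>X _ A. energy j X A) X Y A"
  using assms
proof (induction k arbitrary: X Y A)
  case (Suc k)
  note fin = cycle_free_familyD(1,2,4,5)[OF Suc.prems(1)]
  let ?E = "\<lambda>i. energy (j + i) X A"
  have "(\<Sum>i\<le>Suc k. real (Suc k choose i) * ?E i)
      = ?E 0 + (\<Sum>i\<le>k. real (k choose i) * ?E (Suc i)) + (\<Sum>i\<le>k. real (k choose Suc i) * ?E (Suc i))"
    by (simp add: sum.atMost_Suc_shift sum.distrib algebra_simps del: sum.atMost_Suc)
  also have "(\<Sum>i\<le>k. real (k choose Suc i) * ?E (Suc i)) = (\<Sum>i\<le>Suc k. real (k choose i) * ?E i) - ?E 0"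
    by (simp add: sum.atMost_Suc_shift del: sum.atMost_Suc)
  also have "(\<Sum>i\<le>Suc k. real (k choose i) * ?E i) = (\<Sum>i\<le>k. real (k choose i) * ?E i)" by simp
  also have "?E 0 + (\<Sum>i\<le>k. real (k choose i) * ?E (Suc i)) + ((\<Sum>i\<le>k. real (k choose i) * ?E i) - ?E 0)
      = (\<Sum>i\<le>k. real (k choose i) * (energy (j + i) X A + energy (Suc (j + i)) X A))"
    by (simp add: sum.distrib algebra_simps)
  also have "\<dots> \<le> (\<Sum>i\<le>k. real (k choose i) * (\<Sum>a\<in>X. \<Sum>b\<in>Y. energy (j + i) (X - {a}) (restr A a b)))"
    using Suc.prems(2) by (intro sum_mono mult_left_mono energy_branching fin) auto
  also have "\<dots> = (\<Sum>a\<in>X. \<Sum>b\<in>Y. \<Sum>i\<le>k. real (k choose i) * energy (j + i) (X - {a}) (restr A a b))"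
    unfolding sum_distrib_left by (subst sum.swap, rule sum.cong[OF refl], rule sum.swap)
  also have "\<dots> \<le> (\<Sum>a\<in>X. \<Sum>b\<in>Y. iter_restr k (\<lambda>X _ A. energy j X A) (X - {a}) (Y - {b}) (restr A a b))"
    using Suc.prems fin by (intro sum_mono Suc.IH cycle_free_family_restr[OF Suc.prems(1)]) auto
  finally show ?case by simp
qed simp

section \<open>Extreme degrees and alternating sum for a family\<close>

lemma energy_top_le:
  assumes "cycle_free_family X Y A" "X \<noteq> {}"
  shows "energy (card X - 1) X A \<le> (real (card A))\<^sup>2"
proof -
  have "energy (card X - 1) X A \<le> (\<Sum>f\<in>A. \<Sum>g\<in>A. 1)"
    unfolding energy_def using cycle_free_familyD[OF assms(1)] assms(2)
    by (intro sum_mono pair_trace_top_le)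
  thus ?thesis by (simp add: power2_eq_square)
qed

lemma energy_top:
  assumes A: "cycle_free_family X Y A" and "X \<noteq> {}"
  shows "energy (card X - 1) X A = (real (card A))\<^sup>2"
proof -
  have "pair_trace (card X - 1) X f g = 1" if fg: "f \<in> A" "g \<in> A" for f g
  proof -
    note bij = cycle_free_familyD(5)[OF A fg(2)] and X = cycle_free_familyD(1)[OF A]
      and coh = cycle_free_familyD(8)[OF A fg]
    have "pair_trace (card X - 1) X f g = pair_trace (card X - 1) X g g"
      unfolding pair_trace_def using bij
      by (intro arg_cong2[of _ _ _ _ "(/)"] sum.cong refl coh) (auto intro!: map_in_tuples simp: bij_betw_def)
    also have "\<dots> = 1"
      using pair_trace_refl[OF X assms(2) bij_betw_imp_inj_on[OF bij]] by simp
    finally show ?thesis .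
  qed
  thus ?thesis by (simp add: energy_def power2_eq_square)
qed

lemma energy_alternating_sum:
  assumes A: "cycle_free_family X Y A" and "card X \<ge> 2"
  shows "(\<Sum>j<card X. (-1) ^ j * energy j X A) = 0"
proof -
  have "(\<Sum>j<card X. (-1) ^ j * energy j X A) = (\<Sum>f\<in>A. \<Sum>g\<in>A. \<Sum>j<card X. (-1) ^ j * pair_trace j X f g)"
    unfolding energy_def sum_distrib_left by (subst sum.swap, rule sum.cong[OF refl], rule sum.swap)
  also have "\<dots> = 0"
  proof (rule sum.neutral, intro ballI, rule sum.neutral, intro ballI)
    fix f g assume fg: "f \<in> A" "g \<in> A"
    then obtain U where "U \<subset> X" "U \<noteq> {}" "f ` U = g ` U"
      using cycle_free_familyD(7)[OF A fg order_refl assms(2)] by blast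
    thus "(\<Sum>j<card X. (-1) ^ j * pair_trace j X f g) = 0"
      using cycle_free_familyD(1,5)[OF A] fg by (intro pair_trace_alternating_sum)
  qed
  finally show ?thesis .
qed

section \<open>The size of a family\<close>

lemma central_binomial_Suc: "(2 * Suc j choose Suc j) * Suc j = 2 * (2 * j + 1) * (2 * j choose j)"
proof -
  have "(2 * Suc j choose Suc j) * Suc j = Suc (Suc (2 * j)) * (Suc (2 * j) choose j)"
    using Suc_times_binomial_eq[of "Suc (2 * j)" j] by (simp del: binomial_Suc_Suc)
  also have "\<dots> = 2 * (Suc j * (Suc (2 * j) choose j))" by simp
  also have "Suc j * (Suc (2 * j) choose j) = Suc (2 * j) * (2 * j choose j)"
    using binomial_absorb_comp[of "Suc (2 * j)" j] by simp
  finally show ?thesis by simp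
qed

definition central_bound :: "nat \<Rightarrow> real" where
  "central_bound j = 2 ^ j / real (2 * j choose j)"

lemma central_bound_Suc: "central_bound (Suc j) = real (j + 1) / real (2 * j + 1) * central_bound j"
proof -
  have pos: "real (2 * j choose j) > 0" "real (2 * Suc j choose Suc j) > 0" by (simp_all del: binomial_Suc_Suc)
  have "real (2 * Suc j choose Suc j) * real (j + 1) = 2 * real (2 * j + 1) * real (2 * j choose j)"
    using arg_cong[OF central_binomial_Suc[of j], of real] by (simp del: binomial_Suc_Suc mult_Suc_right)
  hence C: "real (2 * Suc j choose Suc j) = 2 * real (2 * j + 1) * real (2 * j choose j) / real (j + 1)"
    by (simp add: nonzero_eq_divide_eq)
  have cancel: "2 * p / (2 * t * d / s) = s / t * (p / d)" for p t d s :: real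
    by (simp add: mult_ac)
  show ?thesis unfolding central_bound_def C power_Suc by (rule cancel)
qed

text \<open>Domination by a geometric series: the first term \<open>8 / 63\<close> is rounded up to
  \<open>2 / 15\<close>, advancing the index by two costs at least the factor \<open>3 / 10\<close>,
  and \<open>2 / 15 * (10 / 7) = 4 / 21\<close>.\<close>

lemma central_bound_tail: "(\<Sum>i<m. central_bound (5 + 2 * i)) \<le> 4 / 21"
proof -
  have central_bound_5: "central_bound 5 \<le> 2 / 15"
    by (simp add: central_bound_def binomial_fact fact_numeral)
  have pos: "central_bound j > 0" for j by (simp add: central_bound_def)
  have step: "central_bound (7 + 2 * i) \<le> 3 / 10 * central_bound (5 + 2 * i)" for i
  proof -
    have "central_bound (7 + 2 * i) = ((2 * real i + 7) / (4 * real i + 13)) * ((2 * real i + 6) / (4 * real i + 11)) * central_bound (5 + 2 * i)"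
      using central_bound_Suc[of "6 + 2 * i"] central_bound_Suc[of "5 + 2 * i"] by (simp add: add_ac mult_ac)
    moreover have "((2 * real i + 7) / (4 * real i + 13)) * ((2 * real i + 6) / (4 * real i + 11)) \<le> 3 / 10"
    proof -
      have p: "0 < (4 * real i + 13) * (4 * real i + 11)" by simp
      have "(2 * real i + 7) * (2 * real i + 6) * 10 \<le> 3 * ((4 * real i + 13) * (4 * real i + 11))"
        by (simp add: algebra_simps)
      thus ?thesis using p by (simp add: divide_le_eq)
    qed
    ultimately show ?thesis using mult_right_mono[OF _ less_imp_le[OF pos]] by metis
  qed
  \<comment> \<open>Since \<open>10 / 7 = 1 / (1 - 3 / 10)\<close>, the second summand is the
    geometric remainder that lets the induction close.\<close>
  have "(\<Sum>i<m. central_bound (5 + 2 * i)) + 10 / 7 * central_bound (5 + 2 * m) \<le> 10 / 7 * central_bound 5"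
  proof (induction m)
    case (Suc m)
    have "10 / 7 * central_bound (5 + 2 * Suc m) \<le> 3 / 7 * central_bound (5 + 2 * m)" using step[of m] by simp
    thus ?case using Suc by simp
  qed simp
  thus ?thesis using central_bound_5 pos[of "5 + 2 * m"] by simp
qed

text \<open>Taking \<open>k = 2 * j\<close> gives \<open>g j \<le> central_bound j\<close>, but these bounds add up to slightly more than \<open>1\<close>;
  \<open>k = 8\<close> for \<open>j = 3\<close> (where possible) and \<open>g 0 = 1\<close> for \<open>j = 1\<close> make up for it.\<close>

lemma odd_part_less_one:
  fixes g :: "nat \<Rightarrow> real"
  assumes N: "even N" "N \<ge> 2" and g: "\<And>j. j \<le> N \<Longrightarrow> g j \<ge> 0" "g 0 = 1"
    and bound: "\<And>k. even k \<Longrightarrow> k \<le> N \<Longrightarrow> (\<Sum>i\<le>k. real (k choose i) * g i) \<le> 2 ^ (k div 2)"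
  shows "(\<Sum>j | odd j \<and> 2 * j \<le> N. g j) < 1"
proof -
  have single: "real (k choose j) * g j \<le> 2 ^ (k div 2)" if "even k" "k \<le> N" "j \<le> k" for j k
  proof -
    have "real (k choose j) * g j \<le> (\<Sum>i\<le>k. real (k choose i) * g i)"
      using that g(1) by (intro member_le_sum) auto
    thus ?thesis using bound[OF that(1,2)] by simp
  qed
  \<comment> \<open>The case \<open>k = 2\<close> reads \<open>g 0 + 2 * g 1 + g 2 \<le> 2\<close>;
    with \<open>g 0 = 1\<close> this halves the bound \<open>central_bound 1 = 1\<close>.\<close>
  have g1: "g 1 \<le> 1 / 2"
    using bound[of 2] N g(1)[of 2] g(2) by (simp add: numeral_2_eq_2)
  have gb: "g j \<le> central_bound j" if "2 * j \<le> N" for j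
  proof -
    have "real (2 * j choose j) * g j \<le> 2 ^ j" using single[of "2 * j" j] that by simp
    thus ?thesis by (simp add: central_bound_def field_simps)
  qed
  let ?S = "{j. odd j \<and> 2 * j \<le> N}"
  have fin: "finite ?S" by (rule finite_subset[of _ "{..N}"]) auto
  have "N < 6 \<or> N = 6 \<or> N \<ge> 8" using N(1) by presburger
  then consider "N < 6" | "N = 6" | "N \<ge> 8" by blast
  thus ?thesis
  proof cases
    case 1
    hence "?S \<subseteq> {1}" by (auto elim!: oddE)
    hence "sum g ?S \<le> sum g {1}" using N g(1) by (intro sum_mono2) auto
    thus ?thesis using g1 by simp
  next
    case 2
    hence "?S \<subseteq> {1, 3}" by (auto elim!: oddE)
    hence "sum g ?S \<le> sum g {1, 3}" using 2 g(1) by (intro sum_mono2) auto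
    moreover have "g 3 \<le> 2 / 5" using single[of 6 3] 2 by (simp add: binomial_fact fact_numeral)
    ultimately show ?thesis using g1 by simp
  next
    case 3
    have S: "?S = {1, 3} \<union> {j. odd j \<and> 5 \<le> j \<and> 2 * j \<le> N}" (is "_ = _ \<union> ?T")
    proof -
      have "j = 1 \<or> j = 3 \<or> 5 \<le> j" if "odd j" for j :: nat using that by presburger
      thus ?thesis using 3 by auto
    qed
    have fT: "finite ?T" by (rule finite_subset[OF _ fin]) auto
    have "sum g ?S = g 1 + g 3 + sum g ?T"
      unfolding S using fT by (subst sum.union_disjoint) auto
    also have "sum g ?T \<le> sum central_bound ?T" by (intro sum_mono gb) auto
    also have "\<dots> \<le> sum central_bound ((\<lambda>i. 5 + 2 * i) ` {..<N})"
    proof (rule sum_mono2)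
      show "?T \<subseteq> (\<lambda>i. 5 + 2 * i) ` {..<N}"
      proof
        fix j assume "j \<in> ?T"
        hence "j = 5 + 2 * ((j - 5) div 2)" "(j - 5) div 2 < N" by (auto elim!: oddE)
        thus "j \<in> (\<lambda>i. 5 + 2 * i) ` {..<N}" by blast
      qed
    qed (auto simp: central_bound_def)
    also have "\<dots> = (\<Sum>i<N. central_bound (5 + 2 * i))" by (subst sum.reindex) (auto simp: inj_on_def)
    also have "\<dots> \<le> 4 / 21" by (rule central_bound_tail)
    \<comment> \<open>Here \<open>2 ^ 4 / (8 choose 3) = 2 / 7\<close>, and the total is
      \<open>1 / 2 + 2 / 7 + 4 / 21 = 41 / 42\<close>.\<close>
    also have "g 3 \<le> 2 / 7" using single[of 8 3] 3 by (simp add: binomial_fact fact_numeral)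
    finally show ?thesis using g1 by simp
  qed
qed

text \<open>As \<open>N\<close> is even, reflecting \<open>j\<close> to \<open>N - j\<close>
  preserves parity and brings the odd degrees above the middle below it. Each half sums to less than
  \<open>1\<close>, whereas the even degrees \<open>0\<close> and \<open>N\<close> alone contribute
  \<open>2\<close>.\<close>

lemma no_balanced_weights:
  fixes f :: "nat \<Rightarrow> real"
  assumes N: "even N" "N \<ge> 2" and f: "\<And>j. j \<le> N \<Longrightarrow> f j \<ge> 0" "f 0 = 1" "f N = 1"
    and alt: "(\<Sum>j\<le>N. (-1) ^ j * f j) = 0"
    and low: "\<And>k. even k \<Longrightarrow> k \<le> N \<Longrightarrow> (\<Sum>i\<le>k. real (k choose i) * f i) \<le> 2 ^ (k div 2)"
    and high: "\<And>k. even k \<Longrightarrow> k \<le> N \<Longrightarrow> (\<Sum>i\<le>k. real (k choose i) * f (N - i)) \<le> 2 ^ (k div 2)"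
  shows False
proof -
  let ?S = "{j. odd j \<and> 2 * j \<le> N}" and ?O = "{j. j \<le> N \<and> odd j}" and ?E = "{j. j \<le> N \<and> even j}"
  have fin: "finite ?S" by (rule finite_subset[of _ "{..N}"]) auto
  have "(\<Sum>j\<le>N. (-1) ^ j * f j) = (\<Sum>j\<in>?E \<union> ?O. (-1) ^ j * f j)"
    by (rule arg_cong2[of _ _ _ _ sum]) auto
  also have "\<dots> = (\<Sum>j\<in>?E. (-1) ^ j * f j) + (\<Sum>j\<in>?O. (-1) ^ j * f j)"
    by (rule sum.union_disjoint) auto
  also have "\<dots> = sum f ?E - sum f ?O"
    by (simp add: sum_negf)
  finally have "sum f ?E = sum f ?O" using alt by simp
  moreover have "sum f ?E \<ge> sum f {0, N}" using N f(1) by (intro sum_mono2) auto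
  moreover have "sum f ?O \<le> sum f ?S + sum (\<lambda>j. f (N - j)) ?S"
  proof -
    have inj: "inj_on (\<lambda>j. N - j) ?S" by (auto simp: inj_on_def)
    have "j \<in> (\<lambda>j. N - j) ` ?S" if "j \<in> ?O" "\<not> 2 * j \<le> N" for j
      using that N by (intro image_eqI[of _ _ "N - j"]) auto
    hence "?O \<subseteq> ?S \<union> (\<lambda>j. N - j) ` ?S" by blast
    hence "sum f ?O \<le> sum f (?S \<union> (\<lambda>j. N - j) ` ?S)"
      using fin f(1) by (intro sum_mono2) auto
    also have "\<dots> \<le> sum f ?S + sum f ((\<lambda>j. N - j) ` ?S)"
      using fin f(1) by (subst sum_Un) (auto intro!: sum_nonneg)
    finally show ?thesis by (simp add: sum.reindex[OF inj] o_def)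
  qed
  moreover have "sum f ?S < 1" using odd_part_less_one[OF N f(1,2) low] .
  moreover have "sum (\<lambda>j. f (N - j)) ?S < 1"
    using f by (intro odd_part_less_one[OF N _ _ high]) auto
  ultimately show False using N f by simp
qed

section \<open>Induction on the size of the ground set\<close>

theorem cycle_free_family_card:
  assumes "cycle_free_family X Y A" "odd (card X)"
  shows "real (card A) * 2 ^ ((card X - 1) div 2) \<le> fact (card X)"
  using assms
proof (induction "card X" arbitrary: X Y A rule: less_induct)
  case less
  note A = less.prems(1)
  define n a N where "n = card X" and "a = real (card A)" and "N = card X - 1"
  note fin = cycle_free_familyD(1-4)[OF A] and bij = cycle_free_familyD(5)[OF A]
  have ne: "X \<noteq> {}" "Y \<noteq> {}" using less.prems(2) fin by auto
  show ?case
  proof (cases "n = 1")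
    case True
    then obtain x0 y0 where xy: "X = {x0}" "Y = {y0}" using fin by (metis card_1_singletonE n_def)
    have eq: "f = g" if "f \<in> A" "g \<in> A" for f g
    proof (rule cycle_free_familyD(6)[OF A that])
      fix x assume "x \<in> X"
      thus "f x = g x" using bij[OF that(1)] bij[OF that(2)] xy by (simp add: bij_betw_def)
    qed
    have "card A \<le> Suc 0" unfolding card_le_Suc0_iff_eq[OF fin(4)] by (intro ballI eq)
    thus ?thesis using True by (simp add: n_def)
  next
    case False
    hence n: "n \<ge> 3" "odd n" using less.prems(2) n_def by presburger+
    hence N: "even N" "N \<ge> 2" "N < n" "Suc N = n" by (auto simp: N_def n_def)
    show ?thesis
    proof (rule ccontr)
      assume "\<not> ?thesis"
      hence big: "fact n < a * 2 ^ (N div 2)" by (simp add: n_def a_def N_def)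
      hence a: "a > 0" using fact_gt_zero[of n] by (metis less_trans zero_less_mult_pos2 zero_less_numeral zero_less_power)
      define E where "E j = energy j X A" for j
      let ?sq = "\<lambda>X Y A. (real (card A))\<^sup>2"
      \<comment> \<open>For \<open>k > 0\<close> the induction hypothesis, applicable because
        \<open>n - k\<close> is odd, bounds each restricted family by \<open>t\<close>, while the
        sizes total \<open>a * fact n / fact (n - k)\<close>. So the squares total at most
        \<open>a * fact n / 2 ^ ((n - k - 1) div 2)\<close>, and \<open>big\<close> trades
        \<open>fact n\<close> for \<open>a * 2 ^ (N div 2)\<close>.\<close>
      have sq: "iter_restr k ?sq X Y A \<le> 2 ^ (k div 2) * a\<^sup>2" if k: "even k" "k \<le> N" for k
      proof (cases "k = 0")
        case False
        define t where "t = fact (n - k) / (2::real) ^ ((n - k - 1) div 2)"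
        have "iter_restr k ?sq X Y A \<le> iter_restr k (\<lambda>X Y A. t * real (card A)) X Y A"
        proof (rule iter_restr_mono[OF A])
          show "k < card X" using k N by (simp add: n_def)
          fix X' :: "'a set" and Y' :: "'b set" and A' assume A': "cycle_free_family X' Y' A'" "card X' = card X - k"
          have "real (card A') * 2 ^ ((card X' - 1) div 2) \<le> fact (card X')"
          proof (rule less.hyps[OF _ A'(1)])
            show "card X' < card X" "odd (card X')" using A'(2) False k N n by (auto simp: n_def)
          qed
          hence "real (card A') \<le> t" by (simp add: t_def A'(2) n_def field_simps)
          thus "?sq X' Y' A' \<le> t * real (card A')" by (simp add: power2_eq_square mult_right_mono)
        qed
        also have "\<dots> = t * iter_restr k (\<lambda>X Y A. real (card A)) X Y A" by (rule iter_restr_scale)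
        also have "\<dots> = fact n / 2 ^ ((n - k - 1) div 2) * a"
        proof -
          have "fact (n - k) * iter_restr k (\<lambda>X Y A. real (card A)) X Y A = fact n * a"
            using iter_restr_card[OF A, of k] k N by (simp add: n_def a_def)
          thus ?thesis by (simp add: t_def field_simps)
        qed
        also have "\<dots> \<le> 2 ^ (k div 2) * a\<^sup>2"
        proof -
          have "N div 2 = (n - k - 1) div 2 + k div 2" using k N by (auto elim!: evenE)
          hence "fact n \<le> a * (2 ^ ((n - k - 1) div 2) * 2 ^ (k div 2))"
            using big by (simp add: power_add)
          hence "fact n / 2 ^ ((n - k - 1) div 2) \<le> 2 ^ (k div 2) * a"
            by (simp add: field_simps)
          hence "fact n / 2 ^ ((n - k - 1) div 2) * a \<le> 2 ^ (k div 2) * a * a"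
            using a by (intro mult_right_mono) simp_all
          thus ?thesis by (simp only: power2_eq_square mult.assoc)
        qed
        finally show ?thesis .
      qed (simp add: a_def)
      have low: "(\<Sum>i\<le>k. real (k choose i) * E i) \<le> 2 ^ (k div 2) * a\<^sup>2" if k: "even k" "k \<le> N" for k
      proof -
        have "(\<Sum>i\<le>k. real (k choose i) * E i) \<le> iter_restr k (\<lambda>X Y A. energy 0 X A) X Y A"
          using iter_restr_energy[OF A, of 0 k] k N by (simp add: E_def n_def)
        thus ?thesis using sq[OF k] by (simp add: energy_0)
      qed
      \<comment> \<open>Branching started in degree \<open>N - k\<close> ends, after
        \<open>k\<close> prescribed values, in the top degree of sets with \<open>n - k\<close>
        elements, where the energy is again at most the squared size.\<close>
      have high: "(\<Sum>i\<le>k. real (k choose i) * E (N - i)) \<le> 2 ^ (k div 2) * a\<^sup>2" if k: "even k" "k \<le> N" for k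
      proof -
        have "(\<Sum>i\<le>k. real (k choose i) * E (N - i)) = (\<Sum>i\<le>k. real (k choose i) * E (N - k + i))"
          by (rule sum.reindex_bij_witness[of _ "\<lambda>i. k - i" "\<lambda>i. k - i"])
            (use k in \<open>auto simp: binomial_symmetric[symmetric]\<close>)
        also have "\<dots> \<le> iter_restr k (\<lambda>X Y A. energy (N - k) X A) X Y A"
          using iter_restr_energy[OF A, of "N - k" k] k N by (simp add: E_def n_def)
        also have "\<dots> \<le> iter_restr k ?sq X Y A"
        proof (rule iter_restr_mono[OF A])
          show "k < card X" using k N by (simp add: n_def)
          fix X' :: "'a set" and Y' :: "'b set" and A' assume A': "cycle_free_family X' Y' A'" "card X' = card X - k"
          hence "X' \<noteq> {}" "N - k = card X' - 1" using k N by (auto simp: n_def N_def)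
          thus "energy (N - k) X' A' \<le> ?sq X' Y' A'" using energy_top_le[OF A'(1)] by simp
        qed
        finally show ?thesis using sq[OF k] by simp
      qed
      show False
      proof (rule no_balanced_weights[OF N(1,2), of "\<lambda>j. E j / a\<^sup>2"])
        show "E j / a\<^sup>2 \<ge> 0" for j
          using energy_nonneg[OF fin(2) ne(2) bij] by (simp add: E_def)
        show "E 0 / a\<^sup>2 = 1" "E N / a\<^sup>2 = 1"
          using a energy_top[OF A ne(1)] by (simp_all add: E_def energy_0 a_def N_def)
        have "(\<Sum>j\<le>N. (-1) ^ j * E j) = 0"
        proof -
          have "card X = Suc N" "card X \<ge> 2" using N n by (simp_all add: n_def)
          thus ?thesis using energy_alternating_sum[OF A] by (simp add: E_def lessThan_Suc_atMost)
        qed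
        thus "(\<Sum>j\<le>N. (-1) ^ j * (E j / a\<^sup>2)) = 0" by (simp add: sum_divide_distrib[symmetric])
        show "(\<Sum>i\<le>k. real (k choose i) * (E i / a\<^sup>2)) \<le> 2 ^ (k div 2)" if "even k" "k \<le> N" for k
          using low[OF that] a by (simp add: sum_divide_distrib[symmetric] divide_le_eq)
        show "(\<Sum>i\<le>k. real (k choose i) * (E (N - i) / a\<^sup>2)) \<le> 2 ^ (k div 2)" if "even k" "k \<le> N" for k
          using high[OF that] a by (simp add: sum_divide_distrib[symmetric] divide_le_eq)
      qed
    qed
  qed
qed

section \<open>Permutations and labellings\<close>

lemma alternating_append: "alternating f \<Longrightarrow> alternating (\<lambda>xs. f (us @ xs))"
  unfolding alternating_def by (metis append.assoc)

lemma alternating_exchange: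
  assumes "alternating f"
  shows "f (us @ a # vs @ b # ws) = - f (us @ b # vs @ a # ws)"
proof -
  let ?h = "\<lambda>xs. f (us @ xs)"
  have alt: "alternating ?h" by (rule alternating_append[OF assms])
  have "?h ((a # vs) @ b # ws) = (-1) ^ Suc (length vs) * ?h (b # (a # vs) @ ws)"
    using alternating_move[OF alt, of "a # vs" b ws] by simp
  moreover have "?h (b # vs @ a # ws) = (-1) ^ length vs * ?h (b # a # vs @ ws)"
    by (rule alternating_move[OF alternating_Cons[OF alt]])
  ultimately show ?thesis by simp
qed

lemma map_transpose_fresh:
  "a \<notin> set xs \<Longrightarrow> b \<notin> set xs \<Longrightarrow> map (transpose a b) xs = xs"
  by (rule map_idI) (metis transpose_apply_other)

text \<open>The only element of \<open>S\<close> missing from \<open>z\<close> is \<open>b\<close>,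
  so in the vanishing sum over the entry in the place of \<open>a\<close> only the terms for
  \<open>a\<close> and \<open>b\<close> are free of repetitions.\<close>

lemma form_transpose_fresh:
  assumes "finite S" "alternating h" "zero_sum S h" "z \<in> tuples (card S - 1) S" "distinct z"
    and ab: "a \<in> set z" "b \<in> S" "b \<notin> set z"
  shows "h (map (transpose a b) z) = - h z"
proof -
  obtain us vs where z: "z = us @ a # vs" using ab split_list by fast
  have sub: "set z \<subseteq> S" "card (set z) = card S - 1"
    using assms(4) distinct_card[OF assms(5)] by (auto simp: tuples_def)
  have S: "S = insert b (set z)"
  proof -
    have "card S > 0" using ab assms(1) by (auto simp: card_gt_0_iff)
    hence "card (insert b (set z)) = card S" using sub ab by simp
    thus ?thesis using card_subset_eq[OF assms(1), of "insert b (set z)"] sub ab by simp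
  qed
  have fresh: "a \<notin> set (us @ vs)" "b \<notin> set (us @ vs)" "a \<noteq> b" using ab assms(5) z by auto
  have "(\<Sum>y\<in>S. h (y # us @ vs)) = (\<Sum>y\<in>{a, b}. h (y # us @ vs))"
  proof (rule sum.mono_neutral_right)
    show "\<forall>y\<in>S - {a, b}. h (y # us @ vs) = 0"
    proof
      fix y assume "y \<in> S - {a, b}"
      hence "\<not> distinct (y # us @ vs)" unfolding S z by auto
      thus "h (y # us @ vs) = 0" by (rule alternating_not_distinct[OF assms(2)])
    qed
  qed (use S z assms(1) in auto)
  moreover have "(\<Sum>y\<in>S. h (y # us @ vs)) = 0"
    using assms(3) sub z by (simp add: zero_sum_def)
  ultimately have "h (b # us @ vs) = - h (a # us @ vs)" using fresh by simp
  hence "h (us @ b # vs) = - h (us @ a # vs)"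
    using alternating_move[OF assms(2), of us a vs] alternating_move[OF assms(2), of us b vs] by simp
  moreover have "map (transpose a b) z = us @ b # vs"
    using fresh by (simp add: z map_transpose_fresh)
  ultimately show ?thesis by (simp add: z)
qed

lemma form_transpose:
  assumes "finite S" "alternating h" "zero_sum S h" "z \<in> tuples (card S - 1) S" "a \<in> S" "b \<in> S" "a \<noteq> b"
  shows "h (map (transpose a b) z) = - h z"
proof (cases "distinct z")
  case False
  moreover from this have "\<not> distinct (map (transpose a b) z)"
    by (simp add: distinct_map)
  ultimately show ?thesis using alternating_not_distinct[OF assms(2)] by simp
next
  case True
  have sub: "set z \<subseteq> S" "card (set z) = card S - 1"
    using assms(4) distinct_card[OF True] by (auto simp: tuples_def)
  consider "a \<in> set z" "b \<notin> set z" | "b \<in> set z" "a \<notin> set z" | "a \<notin> set z" "b \<notin> set z" | "a \<in> set z" "b \<in> set z"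
    by blast
  thus ?thesis
  proof cases
    case 1
    thus ?thesis using form_transpose_fresh[OF assms(1-4) True] assms by blast
  next
    case 2
    thus ?thesis using form_transpose_fresh[OF assms(1-4) True] assms by (metis transpose_commute)
  next
    case 3
    hence "set z \<subseteq> S - {a, b}" using sub by blast
    hence "card S - 1 \<le> card (S - {a, b})" using sub card_mono[of "S - {a, b}" "set z"] assms(1) by simp
    moreover have "card (S - {a, b}) = card S - 2" using assms by (simp add: card_Diff_subset)
    moreover have "card S \<ge> 2" using card_mono[of S "{a, b}"] assms by simp
    ultimately show ?thesis by linarith
  next
    case 4
    have goal: "h (map (transpose a b) z) = - h z" if z: "z = us @ c # vs @ d # ws" and cd: "{c, d} = {a, b}" for us c vs d ws
    proof -
      have "a \<notin> set (us @ vs @ ws)" "b \<notin> set (us @ vs @ ws)" using True cd assms(7) unfolding z by (auto simp: doubleton_eq_iff)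
      moreover have "transpose a b c = d" "transpose a b d = c" using cd assms(7) by (auto simp: doubleton_eq_iff)
      ultimately have "map (transpose a b) z = us @ d # vs @ c # ws" by (simp add: z map_transpose_fresh)
      thus ?thesis using alternating_exchange[OF assms(2), of us d vs c ws] by (simp add: z)
    qed
    obtain us vs where z: "z = us @ a # vs" using 4 split_list by fast
    hence "b \<in> set us \<or> b \<in> set vs" using 4 assms(7) by auto
    thus ?thesis
    proof
      assume "b \<in> set vs"
      then obtain vs1 vs2 where "vs = vs1 @ b # vs2" using split_list by fast
      thus ?thesis using goal[of us a vs1 b vs2] z by simp
    next
      assume "b \<in> set us"
      then obtain us1 us2 where "us = us1 @ b # us2" using split_list by fast
      thus ?thesis using goal[of us1 b us2 a vs] z by (simp add: insert_commute)
    qed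
  qed
qed

text \<open>The top exterior power of the standard representation is the sign character. This turns
  equality of signs into the condition on \<open>kern\<close> in \<open>cycle_free_family\<close>,
  which makes sense even between different sets.\<close>

lemma form_permute:
  assumes "finite S" "alternating h" "zero_sum S h" "z \<in> tuples (card S - 1) S" "p permutes S"
  shows "h (map p z) = of_int (sign p) * h z"
  using assms(5,1)
proof (induction rule: permutes_induct)
  case (swap a b p)
  have "map p z \<in> tuples (card S - 1) S"
    using assms(4) permutes_image[OF swap.hyps(4)] by (intro map_in_tuples) auto
  hence "h (map (transpose a b) (map p z)) = - h (map p z)"
    using swap.hyps(1-3) by (rule form_transpose[OF assms(1-3)])
  moreover have "sign (transpose a b \<circ> p) = - sign p"
  proof -
    have "permutation p" using swap.hyps(4) assms(1) by (auto simp: permutation_permutes)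
    thus ?thesis using sign_compose[OF permutation_swap_id, of p a b] swap.hyps(3) by (simp add: sign_swap_id)
  qed
  ultimately show ?case using swap.IH by (simp add: o_def)
qed simp

section \<open>From equal label sums to simple cycles\<close>

definition label_sum :: "nat set \<Rightarrow> (nat \<times> nat \<Rightarrow> 'h::ab_group_add) \<Rightarrow> (nat \<Rightarrow> nat) \<Rightarrow> 'h" where
  "label_sum S \<gamma> f = (\<Sum>x\<in>S. \<gamma> (x, f x))"

text \<open>An orbit of \<open>g\<^sup>-\<^sup>1 \<circ> f\<close> has the same image under
  \<open>f\<close> and \<open>g\<close>; if no proper \<open>U\<close> exists, the orbit of a point
  of \<open>Z\<close> is all of \<open>Z\<close>. It then traces a simple cycle of length
  \<open>2 * card Z\<close>, whose alternating sum is the difference of the label sums over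
  \<open>Z\<close>. This is zero, because \<open>f\<close> and \<open>g\<close> agree on the rest of
  \<open>S\<close>.\<close>

lemma equal_label_sum_imp_split:
  fixes \<gamma> :: "nat \<times> nat \<Rightarrow> 'h::ab_group_add"
  assumes free: "simple_cycle_free n \<gamma>" and S: "S \<subseteq> {1..n}"
    and f: "f permutes S" and g: "g permutes S" and eq: "label_sum S \<gamma> f = label_sum S \<gamma> g"
    and Z: "Z \<subseteq> S" "card Z \<ge> 2" "\<And>x. x \<in> S - Z \<Longrightarrow> f x = g x"
  shows "\<exists>U\<subset>Z. U \<noteq> {} \<and> f ` U = g ` U"
proof (rule ccontr)
  assume no: "\<not> ?thesis"
  have fS: "finite S" using S finite_subset by blast
  have fZ: "finite Z" using fS Z finite_subset by blast
  have img: "f ` Z = S - f ` (S - Z)" "g ` Z = S - g ` (S - Z)"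
    using permutes_image[OF f] permutes_image[OF g] image_set_diff[OF permutes_inj[OF f], of S "S - Z"]
      image_set_diff[OF permutes_inj[OF g], of S "S - Z"] Z(1) by (simp_all add: double_diff)
  have "f ` (S - Z) = g ` (S - Z)" using Z(3) by (intro image_cong) auto
  hence fgZ: "f ` Z = g ` Z" using img by simp
  define s where "s = inv_into UNIV g \<circ> f"
  have gs: "g (s x) = f x" for x by (simp add: s_def permutes_inverses(1)[OF g])
  have "s permutes S" unfolding s_def by (rule permutes_compose[OF f permutes_inv[OF g]])
  hence perm: "permutation s" using fS by (auto simp: permutation_permutes)
  have sZ: "s x \<in> Z" if "x \<in> Z" for x
  proof -
    have "f x \<in> g ` Z" using that fgZ by blast
    then obtain y where "y \<in> Z" "f x = g y" by blast
    thus ?thesis by (simp add: s_def permutes_inverses(2)[OF g])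
  qed
  obtain x0 where x0: "x0 \<in> Z" using Z(2) by fastforce
  define m where "m = least_power s x0"
  define w where "w i = (s ^^ i) x0" for i
  have m: "m > 0" "w m = w 0"
    using least_power_of_permutation[OF perm, of x0] by (simp_all add: m_def w_def)
  have w_Suc: "g (w (Suc i)) = f (w i)" for i by (simp add: w_def gs)
  have wZ: "w i \<in> Z" for i by (induction i) (simp_all add: w_def x0 sZ)
  have inj: "inj_on w {..<m}"
    using cycle_of_permutation[OF perm, of x0]
    by (simp add: distinct_map m_def[symmetric] w_def[abs_def] lessThan_atLeast0)
  have shift: "(\<Sum>i<m. h (w (Suc i))) = (\<Sum>i<m. h (w i))" for h :: "nat \<Rightarrow> 'h"
  proof -
    have "(\<Sum>i<Suc m. h (w i)) = h (w 0) + (\<Sum>i<m. h (w (Suc i)))" by (rule sum.lessThan_Suc_shift)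
    thus ?thesis using m by simp
  qed
  have "f ` (w ` {..<m}) = g ` (w ` {..<m})"
  proof -
    have "w ` Suc ` {..<m} = w ` {..<m}"
    proof -
      show ?thesis
      proof
        show "w ` Suc ` {..<m} \<subseteq> w ` {..<m}"
        proof
          fix y assume "y \<in> w ` Suc ` {..<m}"
          then obtain i where "i < m" "y = w (Suc i)" by auto
          thus "y \<in> w ` {..<m}" using m by (cases "Suc i = m") auto
        qed
        show "w ` {..<m} \<subseteq> w ` Suc ` {..<m}"
        proof
          fix y assume "y \<in> w ` {..<m}"
          then obtain i where i: "i < m" "y = w i" by auto
          show "y \<in> w ` Suc ` {..<m}"
          proof (cases i)
            case 0
            hence "y = w (Suc (m - 1))" using i m by simp
            moreover have "m - 1 \<in> {..<m}" using m(1) by simp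
            ultimately show ?thesis by blast
          qed (use i in auto)
        qed
      qed
    qed
    moreover have "f ` (w ` {..<m}) = g ` (w ` Suc ` {..<m})" by (simp add: image_image w_Suc)
    ultimately show ?thesis by simp
  qed
  hence "\<not> w ` {..<m} \<subset> Z" using no m(1) by (metis image_is_empty lessThan_empty_iff neq0_conv)
  hence wimg: "w ` {..<m} = Z" using wZ by blast
  hence m2: "m \<ge> 2" using Z(2) card_image[OF inj] by simp
  \<comment> \<open>The edge from \<open>w k\<close> to \<open>f (w k)\<close> belongs to
    \<open>f\<close> and gets sign plus; the next edge leads back to \<open>w (Suc k)\<close>, whose
    value under \<open>g\<close> is that same \<open>f (w k)\<close>, and gets sign minus.\<close>
  define c where "c = map (\<lambda>i. if even i then Inl (w (i div 2)) else Inr (f (w (i div 2)))) [0..<2 * m]"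
  have len: "length c = 2 * m" by (simp add: c_def)
  have c_even: "c ! (2 * k) = Inl (w k)" and c_odd: "c ! (Suc (2 * k)) = Inr (f (w k))" if "k < m" for k
    using that by (simp_all add: c_def)
  have next_even: "Suc (2 * k) mod length c = Suc (2 * k)" if "k < m" for k
    using that by (simp add: len)
  have next_odd: "c ! (Suc (Suc (2 * k)) mod length c) = Inl (w (Suc k))" if "k < m" for k
  proof (cases "Suc k = m")
    case True
    hence "Suc (Suc (2 * k)) mod length c = 2 * 0" by (auto simp: len)
    thus ?thesis using True m c_even[of 0] by (simp only:)
  next
    case False
    hence k: "Suc k < m" using that by simp
    hence "Suc (Suc (2 * k)) mod length c = 2 * Suc k" by (simp add: len)
    thus ?thesis using c_even[OF k] by (simp only:)
  qed
  have Zn: "x \<in> {1..n}" "f x \<in> {1..n}" if "x \<in> Z" for x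
    using that Z(1) S permutes_in_image[OF f, of x] by auto
  have "simple_cycle n c"
    unfolding simple_cycle_def
  proof (intro conjI allI impI)
    show "\<exists>k\<ge>2. length c = 2 * k" using m2 len by blast
    have w_eq: "i = j" if "w i = w j" "i < m" "j < m" for i j using inj that by (auto simp: inj_on_def)
    show "distinct c"
      unfolding c_def distinct_map
    proof (intro conjI inj_onI)
      fix i j assume ij: "i \<in> set [0..<2 * m]" "j \<in> set [0..<2 * m]"
        and e: "(if even i then Inl (w (i div 2)) else Inr (f (w (i div 2)))) = (if even j then Inl (w (j div 2)) else Inr (f (w (j div 2))))"
      have par: "even i \<longleftrightarrow> even j" using e by (auto split: if_splits)
      have "w (i div 2) = w (j div 2)"
      proof (cases "even i")
        case True
        thus ?thesis using e par by simp
      next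
        case False
        hence "f (w (i div 2)) = f (w (j div 2))" using e par by simp
        thus ?thesis by (rule injD[OF permutes_inj[OF f]])
      qed
      moreover have "i div 2 < m" "j div 2 < m" using ij by auto
      ultimately have "i div 2 = j div 2" by (rule w_eq)
      thus "i = j" using par by presburger
    qed simp
    fix i assume "i < length c"
    hence k: "i div 2 < m" by (simp add: len)
    show "Knn_adj n (c ! i) (c ! (Suc i mod length c))"
    proof (cases "even i")
      case True
      hence i: "i = 2 * (i div 2)" by simp
      show ?thesis
        using c_even[OF k] c_odd[OF k] next_even[OF k] i Zn[OF wZ] by (metis Knn_adj_def)
    next
      case False
      hence i: "i = Suc (2 * (i div 2))" by presburger
      show ?thesis
        using c_odd[OF k] next_odd[OF k] i Zn[OF wZ] by (metis Knn_adj_def)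
    qed
  qed
  moreover have "alternating_sum \<gamma> c = 0"
  proof -
    let ?t = "\<lambda>i. let e = edge_pair (c ! i) (c ! (Suc i mod length c)) in if even i then \<gamma> e else - \<gamma> e"
    have "alternating_sum \<gamma> c = (\<Sum>i<m * 2. ?t i)" by (simp add: alternating_sum_def len mult.commute)
    also have "\<dots> = (\<Sum>k<m. \<Sum>i\<in>{k * 2..<k * 2 + 2}. ?t i)" by (rule sum.nat_group[symmetric])
    also have "\<dots> = (\<Sum>k<m. \<gamma> (w k, f (w k)) - \<gamma> (w (Suc k), g (w (Suc k))))"
    proof (rule sum.cong[OF refl])
      fix k assume "k \<in> {..<m}"
      hence k: "k < m" by simp
      have "{k * 2..<k * 2 + 2} = {2 * k, Suc (2 * k)}" by auto
      hence "(\<Sum>i\<in>{k * 2..<k * 2 + 2}. ?t i) = ?t (2 * k) + ?t (Suc (2 * k))" by simp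
      also have "?t (2 * k) = \<gamma> (w k, f (w k))"
        by (simp only: next_even[OF k] c_even[OF k] c_odd[OF k] edge_pair.simps Let_def) simp
      also have "?t (Suc (2 * k)) = - \<gamma> (w (Suc k), g (w (Suc k)))"
        by (simp only: next_odd[OF k] c_odd[OF k] edge_pair.simps Let_def w_Suc) simp
      finally show "(\<Sum>i\<in>{k * 2..<k * 2 + 2}. ?t i) = \<gamma> (w k, f (w k)) - \<gamma> (w (Suc k), g (w (Suc k)))" by simp
    qed
    also have "\<dots> = (\<Sum>k<m. \<gamma> (w k, f (w k))) - (\<Sum>k<m. \<gamma> (w k, g (w k)))"
      unfolding sum_subtractf shift[of "\<lambda>x. \<gamma> (x, g x)"] ..
    also have "\<dots> = (\<Sum>x\<in>Z. \<gamma> (x, f x)) - (\<Sum>x\<in>Z. \<gamma> (x, g x))"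
      unfolding wimg[symmetric] by (simp add: sum.reindex[OF inj])
    also have "\<dots> = 0"
    proof -
      have "(\<Sum>x\<in>S - Z. \<gamma> (x, f x)) = (\<Sum>x\<in>S - Z. \<gamma> (x, g x))" using Z(3) by (intro sum.cong) auto
      thus ?thesis
        using eq sum.subset_diff[OF Z(1) fS, of "\<lambda>x. \<gamma> (x, f x)"] sum.subset_diff[OF Z(1) fS, of "\<lambda>x. \<gamma> (x, g x)"]
        by (simp add: label_sum_def)
    qed
    finally show ?thesis .
  qed
  ultimately show False using free by (simp add: simple_cycle_free_def)
qed

lemma cycle_free_family_labelling:
  fixes \<gamma> :: "nat \<times> nat \<Rightarrow> 'h::ab_group_add"
  assumes free: "simple_cycle_free n \<gamma>" and S: "S \<subseteq> {1..n}" "S \<noteq> {}"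
  shows "cycle_free_family S S {f. f permutes S \<and> label_sum S \<gamma> f = h \<and> sign f = e}" (is "cycle_free_family S S ?A")
  unfolding cycle_free_family_def
proof (intro conjI ballI allI impI)
  show fS: "finite S" "finite S" using S finite_subset by blast+
  show "finite ?A" using finite_permutations[OF fS(1)] by (rule rev_finite_subset) auto
  show "bij_betw f S S" if "f \<in> ?A" for f using that by (auto intro: permutes_imp_bij)
  fix f g assume fg: "f \<in> ?A" "g \<in> ?A"
  show "f = g" if "\<forall>x\<in>S. f x = g x"
  proof
    fix x show "f x = g x" using that fg by (cases "x \<in> S") (auto simp: permutes_def)
  qed
  show "\<exists>U\<subset>Z. U \<noteq> {} \<and> f ` U = g ` U" if "Z \<subseteq> S" "2 \<le> card Z" "\<forall>x\<in>S - Z. f x = g x" for Z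
    using that fg by (intro equal_label_sum_imp_split[OF free S(1), of f g Z]) auto
  fix x y assume x: "x \<in> tuples (card S - 1) S" and y: "y \<in> tuples (card S - 1) S"
  have "kern (1 / card S) (map p x) y = of_int (sign p) * kern (1 / card S) x y" if "p permutes S" for p
    using y S by (intro form_permute[OF fS(1) _ _ x that] alternating_kern_left zero_sum_kern_left fS)
      (auto simp: tuples_def)
  thus "kern (1 / card S) (map f x) y = kern (1 / card S) (map g x) y" using fg by simp
qed simp

text \<open>Pigeonhole: label sum and sign sort the \<open>fact (card S)\<close> permutations into
  twice as many classes as there are labels, and \<open>cycle_free_family_card\<close> bounds each
  class.\<close>

lemma card_labels_odd:
  fixes \<gamma> :: "nat \<times> nat \<Rightarrow> 'h::ab_group_add"
  assumes free: "simple_cycle_free n \<gamma>" and S: "S \<subseteq> {1..n}" "odd (card S)" and fin: "finite (UNIV :: 'h set)"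
  shows "2 ^ ((card S - 1) div 2) \<le> 2 * real (card (UNIV :: 'h set))"
proof -
  have fS: "finite S" and ne: "S \<noteq> {}" using S finite_subset by fastforce+
  let ?A = "\<lambda>h e. {f. f permutes S \<and> label_sum S \<gamma> f = (h :: 'h) \<and> sign f = e}"
  let ?P = "{f. f permutes S}" and ?I = "(UNIV :: 'h set) \<times> {1, - 1 :: int}"
  have "?P \<subseteq> (\<Union>(h, e)\<in>?I. ?A h e)" by (auto simp: sign_def)
  hence "card ?P \<le> card (\<Union>(h, e)\<in>?I. ?A h e)"
    using fin finite_permutations[OF fS] by (intro card_mono) (auto intro: rev_finite_subset)
  also have "\<dots> \<le> (\<Sum>(h, e)\<in>?I. card (?A h e))"
    using card_UN_le[of ?I "\<lambda>(h, e). ?A h e"] fin by (simp add: case_prod_unfold)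
  finally have "fact (card S) \<le> (\<Sum>(h, e)\<in>?I. card (?A h e))"
    using card_permutations[OF refl fS] by simp
  hence "real (fact (card S)) \<le> real (\<Sum>(h, e)\<in>?I. card (?A h e))" by (simp only: of_nat_le_iff)
  hence "fact (card S) * 2 ^ ((card S - 1) div 2)
      \<le> (\<Sum>(h, e)\<in>?I. real (card (?A h e))) * 2 ^ ((card S - 1) div 2)"
    by (intro mult_right_mono) (simp_all add: case_prod_unfold)
  also have "\<dots> = (\<Sum>(h, e)\<in>?I. real (card (?A h e)) * 2 ^ ((card S - 1) div 2))"
    by (simp add: sum_distrib_right case_prod_unfold)
  also have "\<dots> \<le> (\<Sum>(h, e)\<in>?I. fact (card S))"
    unfolding case_prod_unfold
    by (intro sum_mono cycle_free_family_card[OF cycle_free_family_labelling[OF free S(1) ne] S(2)])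
  also have "\<dots> = 2 * real (card (UNIV :: 'h set)) * fact (card S)"
    using fin by (simp add: card_cartesian_product)
  finally show ?thesis by (simp add: mult.commute)
qed

text \<open>The value of \<open>card\<close> on an infinite set is \<open>0\<close>, so the
  inequality is stated for a finite group; for an infinite one the bound on the order is
  trivial.\<close>

theorem theorem1p4:
  fixes n :: nat and \<gamma> :: "nat \<times> nat \<Rightarrow> 'h::ab_group_add"
  assumes "n \<ge> 1"
    and "simple_cycle_free n \<gamma>"
  shows "finite (UNIV :: 'h set) \<longrightarrow> real (card (UNIV :: 'h set)) \<ge> 2 powr (real n / 2 - 2)"
proof
  assume fin: "finite (UNIV :: 'h set)"
  \<comment> \<open>The largest odd number up to \<open>n\<close> is \<open>2 * k + 1\<close>, and
    \<open>n / 2 - 1 \<le> k\<close>.\<close>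
  define k where "k = (n - 1) div 2"
  have "{1..2 * k + 1} \<subseteq> {1..n}" using assms(1) by (auto simp: k_def)
  from card_labels_odd[OF assms(2) this _ fin]
  have "2 ^ k \<le> 2 * real (card (UNIV :: 'h set))" by simp
  moreover have "real n / 2 - 2 \<le> real k - 1"
  proof -
    have "n \<le> 2 * k + 2" using assms(1) unfolding k_def by presburger
    thus ?thesis by linarith
  qed
  hence "2 powr (real n / 2 - 2) \<le> 2 powr (real k - 1)" by simp
  moreover have "2 powr (real k - 1) = 2 ^ k / (2 :: real)"
    by (simp add: powr_diff powr_realpow)
  ultimately show "real (card (UNIV :: 'h set)) \<ge> 2 powr (real n / 2 - 2)" by linarith
qed

end
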